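(* Let $d\ge1$ be an integer and let $L:C_c^\infty(\mathbb R^d)\to C(\mathbb R^d)$ be a linear operator satisfying the positive maximum principle. For $a_0\in\mathbb R^d$ let $L(a_0):C_c^\infty(\mathbb R^d)\to C_0(\mathbb R^d)$ be the operator $L(a_0)f(a):=L(\tau_{a-a_0}f)(a_0)$, where $\tau_hf(a):=f(a+h)$, and let $(T_t(a_0))_{t\ge0}$ be the Feller semi-group on $C_0(\mathbb R^d)$ whose generator is the closure of $L(a_0)$ in $C_0(\mathbb R^d)\times C_0(\mathbb R^d)$. Let $(\varepsilon_n)_n$ be a sequence of positive numbers such that $\varepsilon_n\to0$ and define the transition operators $T_n$ by $$T_nf(a):=T_{\varepsilon_n}(a)f(a),\qquad f\in C_0(\mathbb R^d),\ a\in\mathbb R^d.$$ Then, for any $f\in C_c^\infty(\mathbb R^d)$, $$\frac1{\varepsilon_n}(T_nf-f)\longrightarrow Lf\quad\text{as }n\to\infty,\ \text{uniformly on compact sets.}$$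
   Context: $C(\mathbb R^d)$: real continuous functions on $\mathbb R^d$. $C_0(\mathbb R^d)$: continuous functions vanishing at infinity, with the uniform norm. $C_c^\infty(\mathbb R^d)$: compactly supported infinitely differentiable real functions. $L$ satisfies the positive maximum principle if for all $f\in C_c^\infty(\mathbb R^d)$ and $a_0\in\mathbb R^d$, $f(a_0)=\sup_{a\in\mathbb R^d}f(a)\ge0$ implies $Lf(a_0)\le0$. A Feller semi-group $(T_t)_{t\ge0}$ is a strongly continuous semi-group of positive linear contractions on $C_0(\mathbb R^d)$; its ($C_0\times C_0$-)generator is the set of $(f,g)\in C_0(\mathbb R^d)\times C_0(\mathbb R^d)$ such that $\lim_{t\to0}\frac1t(T_tf(a)-f(a))=g(a)$ for all $a\in\mathbb R^d$. For each $a_0$, $L(a_0)$ is translation invariant and satisfies the positive maximum principle, and it is a known fact that its closure in $C_0(\mathbb R^d)\times C_0(\mathbb R^d)$ is the generator of a Feller semi-group (of a Lévy process, possibly killed), which is the semi-group $(T_t(a_0))_{t\ge0}$ of the statement. In $T_{\varepsilon_n}(a)f(a)$, the semi-group is frozen at the point $a$ and the resulting function is evaluated at the same point $a$. *)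

theory Defs
  imports "HOL-Analysis.Analysis"
begin

section \<open>Function spaces\<close>

text \<open>
  \<open>C_k k f\<close>: the function is of class \<open>C\<^sup>k\<close>, i.e. it is differentiable and its partial derivatives
  (the values of the Frechet derivative on the standard basis vectors) are of class \<open>C\<^sup>k\<^sup>-\<^sup>1\<close>.
\<close>

primrec C_k :: "nat \<Rightarrow> (real ^ 'n \<Rightarrow> real) \<Rightarrow> bool" where
  "C_k 0 f \<longleftrightarrow> continuous_on UNIV f"
| "C_k (Suc k) f \<longleftrightarrow>
     (\<forall>x. f differentiable (at x)) \<and>
     (\<forall>i. C_k k (\<lambda>x. frechet_derivative f (at x) (axis i 1)))"

definition Cc_infty :: "(real ^ 'n \<Rightarrow> real) set" where
  "Cc_infty = {f. (\<forall>k. C_k k f) \<and> compact (closure {x. f x \<noteq> 0})}"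

definition C_zero :: "(real ^ 'n \<Rightarrow> real) set" where
  "C_zero = {f. continuous_on UNIV f \<and> (f \<longlongrightarrow> 0) at_infinity}"

definition sup_norm :: "(real ^ 'n \<Rightarrow> real) \<Rightarrow> real" where
  "sup_norm f = (SUP x. \<bar>f x\<bar>)"

section \<open>Operators\<close>

text \<open>
  An operator with domain \<open>D\<close> is a total function on all functions, of which only the values on
  \<open>D\<close> matter; every notion below only refers to those.
\<close>

definition linear_operator_on ::
    "(real ^ 'n \<Rightarrow> real) set \<Rightarrow> ((real ^ 'n \<Rightarrow> real) \<Rightarrow> (real ^ 'n \<Rightarrow> real)) \<Rightarrow> bool" where
  "linear_operator_on D L \<longleftrightarrow>
     (\<forall>f\<in>D. \<forall>g\<in>D. L (\<lambda>x. f x + g x) = (\<lambda>x. L f x + L g x)) \<and>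
     (\<forall>c. \<forall>f\<in>D. L (\<lambda>x. c * f x) = (\<lambda>x. c * L f x))"

definition positive_maximum_principle ::
    "((real ^ 'n \<Rightarrow> real) \<Rightarrow> (real ^ 'n \<Rightarrow> real)) \<Rightarrow> bool" where
  "positive_maximum_principle L \<longleftrightarrow>
     (\<forall>f\<in>Cc_infty. \<forall>a0. f a0 = (SUP a. f a) \<and> f a0 \<ge> 0 \<longrightarrow> L f a0 \<le> 0)"

definition translate :: "real ^ 'n \<Rightarrow> (real ^ 'n \<Rightarrow> real) \<Rightarrow> (real ^ 'n \<Rightarrow> real)" where
  "translate h f = (\<lambda>a. f (a + h))"

definition frozen ::
    "((real ^ 'n \<Rightarrow> real) \<Rightarrow> (real ^ 'n \<Rightarrow> real)) \<Rightarrow> real ^ 'n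
      \<Rightarrow> (real ^ 'n \<Rightarrow> real) \<Rightarrow> (real ^ 'n \<Rightarrow> real)" where
  "frozen L a0 f = (\<lambda>a. L (translate (a - a0) f) a0)"

definition operator_graph ::
    "(real ^ 'n \<Rightarrow> real) set \<Rightarrow> ((real ^ 'n \<Rightarrow> real) \<Rightarrow> (real ^ 'n \<Rightarrow> real))
      \<Rightarrow> ((real ^ 'n \<Rightarrow> real) \<times> (real ^ 'n \<Rightarrow> real)) set" where
  "operator_graph D L = {(f, L f) | f. f \<in> D}"

text \<open>
  The closure in \<open>C\<^sub>0 \<times> C\<^sub>0\<close> for the uniform norm on each factor, as the set of limits of sequences.
\<close>

definition C_zero_closure ::
    "((real ^ 'n \<Rightarrow> real) \<times> (real ^ 'n \<Rightarrow> real)) set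
      \<Rightarrow> ((real ^ 'n \<Rightarrow> real) \<times> (real ^ 'n \<Rightarrow> real)) set" where
  "C_zero_closure A =
     {(f, g). f \<in> C_zero \<and> g \<in> C_zero \<and>
        (\<exists>F G. (\<forall>m::nat. (F m, G m) \<in> A) \<and>
               uniform_limit UNIV F f sequentially \<and>
               uniform_limit UNIV G g sequentially)}"

section \<open>Feller semi-groups\<close>

definition feller_semigroup ::
    "(real \<Rightarrow> (real ^ 'n \<Rightarrow> real) \<Rightarrow> (real ^ 'n \<Rightarrow> real)) \<Rightarrow> bool" where
  "feller_semigroup T \<longleftrightarrow>
     (\<forall>t\<ge>0. \<forall>f\<in>C_zero. T t f \<in> C_zero) \<and>
     (\<forall>t\<ge>0. linear_operator_on C_zero (T t)) \<and>
     (\<forall>t\<ge>0. \<forall>f\<in>C_zero. (\<forall>a. 0 \<le> f a) \<longrightarrow> (\<forall>a. 0 \<le> T t f a)) \<and>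
     (\<forall>t\<ge>0. \<forall>f\<in>C_zero. sup_norm (T t f) \<le> sup_norm f) \<and>
     (\<forall>f\<in>C_zero. T 0 f = f) \<and>
     (\<forall>s\<ge>0. \<forall>t\<ge>0. \<forall>f\<in>C_zero. T (s + t) f = T s (T t f)) \<and>
     (\<forall>f\<in>C_zero. ((\<lambda>t. sup_norm (\<lambda>a. T t f a - f a)) \<longlongrightarrow> 0) (at_right 0))"

text \<open>The limit defining the generator is taken pointwise, not in the uniform norm.\<close>

definition feller_generator ::
    "(real \<Rightarrow> (real ^ 'n \<Rightarrow> real) \<Rightarrow> (real ^ 'n \<Rightarrow> real))
      \<Rightarrow> ((real ^ 'n \<Rightarrow> real) \<times> (real ^ 'n \<Rightarrow> real)) set" where
  "feller_generator T =
     {(f, g). f \<in> C_zero \<and> g \<in> C_zero \<and>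
        (\<forall>a. ((\<lambda>t. (1 / t) * (T t f a - f a)) \<longlongrightarrow> g a) (at_right 0))}"

text \<open>The semi-group is frozen at the point at which the resulting function is evaluated.\<close>

definition transition_operator ::
    "(real ^ 'n \<Rightarrow> real \<Rightarrow> (real ^ 'n \<Rightarrow> real) \<Rightarrow> (real ^ 'n \<Rightarrow> real)) \<Rightarrow> real
      \<Rightarrow> (real ^ 'n \<Rightarrow> real) \<Rightarrow> (real ^ 'n \<Rightarrow> real)" where
  "transition_operator T t f = (\<lambda>a. T a t f a)"

end

(* Write g_a = L(a) f. A mean value formula for the semi-group gives, for each a, some s in (0, eps) with
   (T_eps(a) f(a) - f(a)) / eps = T_s(a) g_a(a), whereas L f(a) = g_a(a). So it is enough that
   T_s(a) g_a(a) - g_a(a) tends to 0 as s -> 0, uniformly for a in a compact set K. The positive maximum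
   principle bounds |L f(a)|, for a in K, by a constant times the C^2 norm of f, whatever the support of f.
   Hence the g_a are uniformly bounded and uniformly Lipschitz, and for a bump phi_a equal to 1 at a, the
   same mean value formula gives 1 - T_s(a) phi_a(a) = O(s) uniformly; by positivity the mass leaving a
   neighbourhood of a is then O(s), which controls T_s(a) g_a(a) - g_a(a). *)

theory Submission
  imports Defs
begin

section \<open>Smooth functions with compact support\<close>

text \<open>The semi-groups \<open>T a\<close> are unrelated for different \<open>a\<close>, so
  strong continuity of each gives no rate uniform in \<open>a\<close>: every rate must come from
  \<open>L\<close>, with constants valid on K. The C^2 bound is uniform because the second order
  polynomials at all points of K, cut off by one bump phi, are combinations of phi, x_i phi and
  x_i^2 phi; continuity of \<open>L\<close> applied to these 2d+1 functions bounds everything. C^2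
  norms are invariant under translation, so g_a is controlled on the whole space although a stays in
  K; its Lipschitz bound costs a third derivative. To enter the closure of L(a), g_a must also
  vanish at infinity, which the maximum principle yields by piling up distant bumps. The mean value
  formula needs t -> T_t f(a) to be differentiable, whereas the generator only has a pointwise limit
  at 0; the resolvent of the semi-group discounted at rate 1 bridges this gap. The final error is an
  oscillation part C \<delta>, with \<delta> the radius of the support of phi_a, plus a lost mass
  part 2 M M' \<epsilon>. M' depends on \<delta>, so \<delta> is fixed before \<epsilon> tends to
  0.\<close>

abbreviation partial_deriv :: "'n \<Rightarrow> (real ^ 'n \<Rightarrow> real) \<Rightarrow> real ^ 'n \<Rightarrow> real" where
  "partial_deriv i f \<equiv> \<lambda>x. frechet_derivative f (at x) (axis i 1)"

text \<open>The derivative is supplied as a witness \<open>f'\<close>, so smoothness proofs can run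
  on the derivative rules instead of computing \<open>frechet_derivative\<close>.\<close>

lemma C_k_SucI:
  fixes f :: "real ^ 'n \<Rightarrow> real"
  assumes "\<And>x. (f has_derivative f' x) (at x)"
    and "\<And>i. C_k k (\<lambda>x. f' x (axis i 1))"
  shows "C_k (Suc k) f"
proof -
  have "frechet_derivative f (at x) = f' x" for x
    using assms(1) frechet_derivative_at by metis
  then show ?thesis using assms by (auto simp: differentiable_def)
qed

lemma C_k_Suc_has_derivative:
  "C_k (Suc k) f \<Longrightarrow> (f has_derivative frechet_derivative f (at x)) (at x)"
  by (simp add: frechet_derivative_works)

lemma C_k_SucD: "C_k (Suc k) f \<Longrightarrow> C_k k f"
proof (induction k arbitrary: f)
  case 0
  then show ?case
    by (auto simp: continuous_at_imp_continuous_on differentiable_imp_continuous_within)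
next
  case (Suc k)
  then show ?case by (metis C_k.simps(2))
qed

lemma C_k_const: "C_k k (\<lambda>x. c)"
proof (induction k arbitrary: c)
  case (Suc k)
  show ?case by (rule C_k_SucI[where f' = "\<lambda>x h. 0"]) (auto intro: Suc)
qed simp

lemma C_k_component: "C_k k (\<lambda>x :: real ^ 'n. x $ i)"
proof (cases k)
  case (Suc m)
  have "((\<lambda>x. x $ i) has_derivative (\<lambda>h. h $ i)) (at x)" for x :: "real ^ 'n"
    by (intro bounded_linear_imp_has_derivative bounded_linear_vec_nth)
  then show ?thesis unfolding Suc by (rule C_k_SucI) (rule C_k_const)
qed (auto intro: continuous_intros)

lemma C_k_add: "C_k k f \<Longrightarrow> C_k k g \<Longrightarrow> C_k k (\<lambda>x. f x + g x)"
proof (induction k arbitrary: f g)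
  case (Suc k)
  show ?case
    by (rule C_k_SucI[OF has_derivative_add[OF C_k_Suc_has_derivative[OF Suc.prems(1)]
          C_k_Suc_has_derivative[OF Suc.prems(2)]]])
      (rule Suc.IH, use Suc.prems in simp_all)
qed (auto intro: continuous_intros)

lemma C_k_mult: "C_k k f \<Longrightarrow> C_k k g \<Longrightarrow> C_k k (\<lambda>x. f x * g x)"
proof (induction k arbitrary: f g)
  case (Suc k)
  have *: "C_k k f" "C_k k g" using Suc.prems C_k_SucD by auto
  show ?case
    by (rule C_k_SucI[OF has_derivative_mult[OF C_k_Suc_has_derivative[OF Suc.prems(1)]
          C_k_Suc_has_derivative[OF Suc.prems(2)]]])
      (rule C_k_add; rule Suc.IH; use Suc.prems * in simp)
qed (auto intro: continuous_intros)

lemma C_k_sum: "(\<And>i. i \<in> I \<Longrightarrow> C_k k (f i)) \<Longrightarrow> C_k k (\<lambda>x. \<Sum>i\<in>I. f i x)"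
  by (induction I rule: infinite_finite_induct) (auto intro: C_k_const C_k_add)

text \<open>The induction on \<open>k\<close> replaces \<open>g\<close> by its derivative, so it has
  to run over a whole class \<open>G\<close> stable under differentiation;
  \<open>range flat_fun\<close> will be such a class.\<close>

lemma C_k_compose:
  fixes u :: "real ^ 'n \<Rightarrow> real"
  assumes closed: "\<And>g. g \<in> G \<Longrightarrow> \<exists>g'\<in>G. \<forall>x. (g has_real_derivative g' x) (at x)"
  shows "g \<in> G \<Longrightarrow> C_k k u \<Longrightarrow> C_k k (\<lambda>x. g (u x))"
proof (induction k arbitrary: g)
  case 0
  have "isCont g x" for x using closed[OF 0(1)] DERIV_isCont by blast
  then have "continuous_on UNIV g" by (intro continuous_at_imp_continuous_on) blast
  then show ?case using 0 by (auto intro: continuous_on_compose2)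
next
  case (Suc k)
  obtain g' where g': "g' \<in> G" "\<And>x. (g has_real_derivative g' x) (at x)"
    using closed[OF Suc.prems(1)] by blast
  have u: "C_k k u" using Suc.prems C_k_SucD by auto
  have "((\<lambda>x. g (u x)) has_derivative (\<lambda>h. g' (u x) * frechet_derivative u (at x) h)) (at x)" for x
    using has_derivative_compose[OF C_k_Suc_has_derivative[OF Suc.prems(2)] g'(2)[unfolded has_field_derivative_def]] .
  then show ?case
    by (rule C_k_SucI) (rule C_k_mult[OF Suc.IH[OF g'(1) u]], use Suc.prems in simp)
qed

lemma frechet_derivative_translate:
  fixes f :: "real ^ 'n \<Rightarrow> real"
  assumes "\<And>x. f differentiable (at x)"
  shows "(translate h f has_derivative frechet_derivative f (at (x + h))) (at x)"
proof -
  have "((\<lambda>x. x + h) has_derivative (\<lambda>y. y)) (at x)" by (auto intro!: derivative_eq_intros)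
  from has_derivative_compose[OF this frechet_derivative_works[THEN iffD1, OF assms]]
  show ?thesis by (simp add: translate_def)
qed

lemma C_k_translate: "C_k k f \<Longrightarrow> C_k k (translate h f)"
proof (induction k arbitrary: f)
  case 0
  then show ?case
    by (auto simp: translate_def intro!: continuous_on_compose2[of UNIV f] continuous_intros)
next
  case (Suc k)
  have "C_k k (translate h (partial_deriv i f))" for i using Suc by auto
  then show ?case
    using Suc.prems by (intro C_k_SucI[OF frechet_derivative_translate]) (auto simp: translate_def)
qed

text \<open>For \<open>p = 1\<close> this is the classical smooth function exp(-1/x) extended by 0.
  The polynomial in 1/x makes the family stable under differentiation: p becomes X^2 (p -
  p').\<close>

definition flat_fun :: "real poly \<Rightarrow> real \<Rightarrow> real" where
  "flat_fun p x = (if x > 0 then poly p (1 / x) * exp (- (1 / x)) else 0)"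

lemma tendsto_poly_exp_minus: "((\<lambda>y. poly p y * exp (- y)) \<longlongrightarrow> 0) (at_top :: real filter)"
proof -
  have "((\<lambda>y. \<Sum>i\<le>degree p. coeff p i * (y ^ i / exp y)) \<longlongrightarrow> (\<Sum>i\<le>degree p. coeff p i * 0)) at_top"
    by (intro tendsto_sum tendsto_mult tendsto_const tendsto_power_div_exp_0)
  then show ?thesis
    by (simp add: poly_altdef sum_distrib_right exp_minus divide_inverse mult.assoc)
qed

lemma flat_fun_tendsto_0: "(flat_fun p \<longlongrightarrow> 0) (at 0)"
proof -
  have "((\<lambda>x. poly p (inverse x) * exp (- inverse x)) \<longlongrightarrow> 0) (at_right 0)"
    using filterlim_compose[OF tendsto_poly_exp_minus filterlim_inverse_at_top_right] .
  then have "(flat_fun p \<longlongrightarrow> 0) (at_right 0)"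
    by (rule Lim_transform_eventually)
      (auto simp: flat_fun_def inverse_eq_divide eventually_at_filter)
  moreover have "(flat_fun p \<longlongrightarrow> 0) (at_left 0)"
    by (rule tendsto_eventually) (auto simp: flat_fun_def eventually_at_filter)
  ultimately show ?thesis by (simp add: filterlim_split_at)
qed

lemma DERIV_flat_fun:
  "(flat_fun p has_real_derivative flat_fun ([:0, 0, 1:] * (p - pderiv p)) x) (at x)"
proof (cases x "0 :: real" rule: linorder_cases)
  case less
  have "((\<lambda>_. 0) has_real_derivative 0) (at x)" by simp
  then have "(flat_fun p has_real_derivative 0) (at x)"
    by (rule has_field_derivative_transform_within_open[of _ _ _ "{..<0}"])
      (use less in \<open>auto simp: flat_fun_def\<close>)
  then show ?thesis using less by (simp add: flat_fun_def)
next
  case equal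
  \<comment> \<open>The difference quotient at 0 is itself a member of the family, with polynomial X
    p, so the limit at 0 already proved gives derivative 0.\<close>
  have "flat_fun p h / h = flat_fun ([:0, 1:] * p) h" for h by (simp add: flat_fun_def)
  then have "((\<lambda>h. (flat_fun p (0 + h) - flat_fun p 0) / h) \<longlongrightarrow> 0) (at 0)"
    using flat_fun_tendsto_0[of "[:0, 1:] * p"] by (simp add: flat_fun_def[of _ 0])
  then show ?thesis unfolding equal by (simp add: DERIV_def flat_fun_def[of _ 0])
next
  case greater
  have d: "((\<lambda>x. 1 / x) has_real_derivative - (1 / x\<^sup>2)) (at x)"
    using greater by (auto intro!: derivative_eq_intros simp: power2_eq_square)
  have "((\<lambda>x. poly p (1 / x) * exp (- (1 / x))) has_real_derivative
      flat_fun ([:0, 0, 1:] * (p - pderiv p)) x) (at x)"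
    using DERIV_mult[OF DERIV_chain2[OF poly_DERIV d] DERIV_fun_exp[OF DERIV_minus[OF d]]] greater
    by (simp add: flat_fun_def algebra_simps power2_eq_square)
  then show ?thesis
    by (rule has_field_derivative_transform_within_open[of _ _ _ "{0<..}"])
      (use greater in \<open>auto simp: flat_fun_def\<close>)
qed

lemma C_k_flat_fun: "C_k k u \<Longrightarrow> C_k k (\<lambda>x. flat_fun p (u x))"
  by (rule C_k_compose[of "range flat_fun"]) (use DERIV_flat_fun in blast)+

text \<open>Together with \<open>Cc_infty_vanishes\<close>, this trades the compact closure of the
  support for a radius, the form in which all supports are handled below.\<close>

lemma Cc_inftyI:
  fixes f :: "real ^ 'n \<Rightarrow> real"
  assumes "\<And>k. C_k k f" and "\<And>x. norm x \<ge> r \<Longrightarrow> f x = 0"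
  shows "f \<in> Cc_infty"
proof -
  have "{x. f x \<noteq> 0} \<subseteq> cball 0 r" using assms(2) by (force simp: not_le)
  then have "bounded {x. f x \<noteq> 0}" using bounded_subset bounded_cball by blast
  then show ?thesis using assms(1) by (auto simp: Cc_infty_def compact_closure)
qed

lemma Cc_infty_vanishes:
  fixes f :: "real ^ 'n \<Rightarrow> real"
  assumes "f \<in> Cc_infty"
  shows "\<exists>r. \<forall>x. norm x \<ge> r \<longrightarrow> f x = 0"
proof -
  have "bounded {x. f x \<noteq> 0}"
    using assms by (simp add: Cc_infty_def compact_closure)
  then obtain r where r: "r > 0" "\<forall>x\<in>{x. f x \<noteq> 0}. norm x < r"
    unfolding bounded_pos_less by blast
  then show ?thesis by (intro exI[of _ r]) force
qed

lemma Cc_infty_C_k: "f \<in> Cc_infty \<Longrightarrow> C_k k f"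
  by (simp add: Cc_infty_def)

lemma Cc_infty_continuous: "f \<in> Cc_infty \<Longrightarrow> continuous_on UNIV f"
  using Cc_infty_C_k[of f 0] by simp

lemma Cc_infty_differentiable: "f \<in> Cc_infty \<Longrightarrow> f differentiable (at x)"
  using Cc_infty_C_k[of f 1] by simp

lemma bump_exists:
  assumes "r > 0"
  obtains \<phi> :: "real ^ 'n \<Rightarrow> real" where "\<phi> \<in> Cc_infty" "\<And>x. 0 \<le> \<phi> x" "\<And>x. \<phi> x \<le> 1"
    "\<And>x. norm x \<le> r \<Longrightarrow> \<phi> x = 1" "\<And>x. norm x \<ge> 2 * r \<Longrightarrow> \<phi> x = 0"
proof -
  \<comment> \<open>With E(x) = exp(-1/x) for x > 0 and 0 otherwise, w = 1/2 - E(|x|^2/r^2 - 1). On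
    |x| \<le> r, w = 1/2 and E(1/2) = exp(-2), which the factor exp 2 normalises to 1. On |x| \<ge>
    2r the argument is at least 3 and E \<ge> 1 - 1/3 > 1/2, so w \<le> 0 and E(w) = 0. Only sums
    and products appear, matching the closure rules for \<open>C_k\<close>.\<close>
  define w where "w = (\<lambda>x :: real ^ 'n. 1/2 + (-1) * flat_fun 1 ((1/r\<^sup>2) * (\<Sum>i\<in>UNIV. x $ i * x $ i) + (-1)))"
  define \<phi> where "\<phi> = (\<lambda>x :: real ^ 'n. exp 2 * flat_fun 1 (w x))"
  have sm: "C_k k \<phi>" for k
    unfolding \<phi>_def w_def by (intro C_k_mult C_k_const C_k_flat_fun C_k_add C_k_sum C_k_component)
  have w: "w x = 1/2 - flat_fun 1 ((norm x)\<^sup>2 / r\<^sup>2 - 1)" for x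
    unfolding w_def by (simp add: norm_vec_def L2_set_def power2_eq_square sum_nonneg)
  have 0: "0 \<le> \<phi> x" for x by (simp add: \<phi>_def flat_fun_def)
  have "w x \<le> 1/2" for x by (simp add: w flat_fun_def)
  then have "flat_fun 1 (w x) \<le> exp (- 2)" for x
    by (simp add: flat_fun_def field_simps)
  then have "\<phi> x \<le> exp 2 * exp (- 2)" for x
    unfolding \<phi>_def by (intro mult_left_mono) auto
  then have 1: "\<phi> x \<le> 1" for x by (simp add: exp_minus)
  have 2: "\<phi> x = 1" if "norm x \<le> r" for x
  proof -
    have "(norm x)\<^sup>2 / r\<^sup>2 \<le> 1" using that assms by (simp add: power_mono)
    then have w2: "w x = 1/2" by (simp add: w flat_fun_def)
    show ?thesis unfolding \<phi>_def w2 by (simp add: flat_fun_def exp_minus)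
  qed
  have 3: "\<phi> x = 0" if "norm x \<ge> 2 * r" for x
  proof -
    have "(2 * r)\<^sup>2 \<le> (norm x)\<^sup>2" using that assms by (intro power_mono) auto
    then have s: "(norm x)\<^sup>2 / r\<^sup>2 - 1 \<ge> 3" (is "?s \<ge> 3")
      using assms by (simp add: field_simps power_mult_distrib)
    have "1 + (- (1 / ?s)) \<le> exp (- (1 / ?s))" by (rule exp_ge_add_one_self)
    moreover have "1 / t \<le> 1 / 3" if "t \<ge> 3" for t :: real using that by (simp add: field_simps)
    from this[OF s] have "1 / ?s \<le> 1 / 3" .
    ultimately have "1 / 2 \<le> exp (- (1 / ?s))" by linarith
    then have "w x \<le> 0" using s by (simp add: w flat_fun_def)
    then show ?thesis by (simp add: \<phi>_def flat_fun_def)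
  qed
  show thesis
    by (rule that[OF Cc_inftyI[OF sm 3] 0 1 2 3])
qed

section \<open>Closure properties and boundedness of test functions\<close>

lemma Cc_infty_add:
  assumes f: "f \<in> Cc_infty" and g: "g \<in> Cc_infty"
  shows "(\<lambda>x. f x + g x) \<in> Cc_infty"
proof -
  obtain r where r: "\<And>x. norm x \<ge> r \<Longrightarrow> f x = 0" using Cc_infty_vanishes[OF f] by blast
  obtain s where s: "\<And>x. norm x \<ge> s \<Longrightarrow> g x = 0" using Cc_infty_vanishes[OF g] by blast
  show ?thesis
  proof (rule Cc_inftyI[of _ "max r s"])
    show "C_k k (\<lambda>x. f x + g x)" for k by (rule C_k_add[OF f[THEN Cc_infty_C_k] g[THEN Cc_infty_C_k]])
  qed (use r s in auto)
qed

lemma Cc_infty_mult: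
  assumes f: "\<And>k. C_k k f" and g: "g \<in> Cc_infty"
  shows "(\<lambda>x. f x * g x) \<in> Cc_infty"
proof -
  obtain s where s: "\<And>x. norm x \<ge> s \<Longrightarrow> g x = 0" using Cc_infty_vanishes[OF g] by blast
  show ?thesis
  proof (rule Cc_inftyI[of _ s])
    show "C_k k (\<lambda>x. f x * g x)" for k by (rule C_k_mult[OF f g[THEN Cc_infty_C_k]])
  qed (use s in auto)
qed

lemma Cc_infty_cmult: "f \<in> Cc_infty \<Longrightarrow> (\<lambda>x. c * f x) \<in> Cc_infty"
  by (intro Cc_infty_mult C_k_const)

lemma Cc_infty_diff:
  assumes "f \<in> Cc_infty" "g \<in> Cc_infty" shows "(\<lambda>x. f x - g x) \<in> Cc_infty"
  using Cc_infty_add[OF assms(1) Cc_infty_cmult[OF assms(2), of "-1"]] by simp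

lemma Cc_infty_sum:
  assumes "finite I" "\<And>i. i \<in> I \<Longrightarrow> F i \<in> Cc_infty"
  shows "(\<lambda>x. \<Sum>i\<in>I. F i x) \<in> Cc_infty"
  using assms
proof (induction I rule: finite_induct)
  case empty
  show ?case by (auto intro!: Cc_inftyI[of _ 0] C_k_const)
qed (auto intro!: Cc_infty_add)

lemma Cc_infty_translate:
  assumes "f \<in> Cc_infty" shows "translate h f \<in> Cc_infty"
proof -
  obtain r where r: "\<And>x. norm x \<ge> r \<Longrightarrow> f x = 0" using Cc_infty_vanishes[OF assms] by blast
  show ?thesis
  proof (rule Cc_inftyI[of _ "r + norm h"])
    show "C_k k (translate h f)" for k by (intro C_k_translate Cc_infty_C_k assms)
    show "translate h f x = 0" if "norm x \<ge> r + norm h" for x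
      using that norm_diff_ineq[of x h] r[of "x + h"] by (simp add: translate_def)
  qed
qed

lemma Cc_infty_partial_deriv:
  assumes "f \<in> Cc_infty" shows "partial_deriv i f \<in> Cc_infty"
proof -
  obtain r where r: "\<And>x. norm x \<ge> r \<Longrightarrow> f x = 0" using Cc_infty_vanishes[OF assms] by blast
  show ?thesis
  \<comment> \<open>The extra unit places each such point in the open complement of the closed ball
    of radius \<open>r\<close>, where \<open>f\<close> vanishes identically and can be
    differentiated as a constant.\<close>
  proof (rule Cc_inftyI[of _ "r + 1"])
    show "C_k k (partial_deriv i f)" for k using Cc_infty_C_k[OF assms, of "Suc k"] by simp
    show "partial_deriv i f x = 0" if "norm x \<ge> r + 1" for x
    proof -
      have "((\<lambda>_. 0) has_derivative (\<lambda>_. 0)) (at x)" by simp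
      then have "(f has_derivative (\<lambda>_. 0)) (at x)"
        by (rule has_derivative_transform_within_open[of _ _ _ _ "- cball 0 r"])
          (use that r in auto)
      then show ?thesis using frechet_derivative_at by metis
    qed
  qed
qed

lemma Cc_infty_bounded:
  fixes f :: "real ^ 'n \<Rightarrow> real"
  assumes "f \<in> Cc_infty" shows "\<exists>M\<ge>0. \<forall>x. \<bar>f x\<bar> \<le> M"
proof -
  obtain r where r: "\<And>x. norm x \<ge> r \<Longrightarrow> f x = 0" using Cc_infty_vanishes[OF assms] by blast
  have "bounded (f ` cball 0 r)"
    using Cc_infty_continuous[OF assms]
    by (intro compact_imp_bounded compact_continuous_image) (auto intro: continuous_on_subset)
  then obtain M where M: "M > 0" "\<forall>y\<in>f ` cball 0 r. norm y \<le> M" unfolding bounded_pos by blast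
  have "\<bar>f x\<bar> \<le> M" for x using M r[of x] by (cases "norm x \<le> r") auto
  then show ?thesis using M(1) by (intro exI[of _ M]) auto
qed

lemma Cc_infty_C_zero: "f \<in> Cc_infty \<Longrightarrow> f \<in> C_zero"
proof -
  assume f: "f \<in> Cc_infty"
  obtain r where r: "\<And>x. norm x \<ge> r \<Longrightarrow> f x = 0" using Cc_infty_vanishes[OF f] by blast
  have "(f \<longlongrightarrow> 0) at_infinity"
    by (rule tendsto_eventually) (use r in \<open>auto simp: eventually_at_infinity\<close>)
  then show ?thesis using Cc_infty_continuous[OF f] by (simp add: C_zero_def)
qed

section \<open>Mean value estimates, C^k bounds and second order Taylor remainder\<close>

lemma frechet_derivative_eq_sum:
  fixes f :: "real ^ 'n \<Rightarrow> real"
  assumes "f differentiable (at x)"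
  shows "frechet_derivative f (at x) h = (\<Sum>i\<in>UNIV. partial_deriv i f x * h $ i)"
proof -
  have l: "linear (frechet_derivative f (at x))"
    using assms by (rule linear_frechet_derivative)
  have "frechet_derivative f (at x) h = frechet_derivative f (at x) (\<Sum>i\<in>UNIV. h $ i *\<^sub>R axis i 1)"
    using basis_expansion[of h] by (simp add: scalar_mult_eq_scaleR)
  also have "\<dots> = (\<Sum>i\<in>UNIV. h $ i *\<^sub>R partial_deriv i f x)"
    by (simp add: linear_sum[OF l] linear_scale[OF l])
  finally show ?thesis by (simp add: mult.commute)
qed

text \<open>This is the one-dimensional mean value theorem on the segment from \<open>a\<close> to
  \<open>y\<close>. Keeping \<open>z\<close> no farther from \<open>a\<close> than \<open>y\<close>
  allows a second application, to the partial derivatives, in the Taylor estimate.\<close>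

lemma mvt_partial_deriv:
  fixes f :: "real ^ 'n \<Rightarrow> real"
  assumes "\<And>x. f differentiable (at x)"
  shows "\<exists>z. norm (z - a) \<le> norm (y - a) \<and> f y - f a = (\<Sum>i\<in>UNIV. partial_deriv i f z * (y - a) $ i)"
proof -
  define p where "p t = a + t *\<^sub>R (y - a)" for t :: real
  have p: "(p has_derivative (\<lambda>s. s *\<^sub>R (y - a))) (at t within S)" for t S
    unfolding p_def by (auto intro!: derivative_eq_intros)
  have "((\<lambda>t. f (p t)) has_derivative (\<lambda>s. frechet_derivative f (at (p t)) (s *\<^sub>R (y - a)))) (at t within {0..1})" for t
    by (rule has_derivative_compose[OF p frechet_derivative_works[THEN iffD1, OF assms]])
  then obtain t where t: "t \<in> {0<..<1}"
    "f (p 1) - f (p 0) = frechet_derivative f (at (p t)) ((1 - 0) *\<^sub>R (y - a))"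
    using mvt_simple[of 0 1 "\<lambda>t. f (p t)" "\<lambda>t s. frechet_derivative f (at (p t)) (s *\<^sub>R (y - a))"]
    by auto
  have "norm (p t - a) \<le> norm (y - a)"
    using t(1) by (simp add: p_def mult_left_le_one_le)
  moreover have "f y - f a = frechet_derivative f (at (p t)) (y - a)"
    using t(2) by (simp add: p_def)
  ultimately show ?thesis
    using frechet_derivative_eq_sum[OF assms, of "p t" "y - a"] by (intro exI[of _ "p t"]) simp
qed

lemma partial_deriv_lipschitz:
  fixes f :: "real ^ 'n \<Rightarrow> real"
    and M :: real
  assumes "\<And>x. f differentiable (at x)" and "\<And>i x. \<bar>partial_deriv i f x\<bar> \<le> M"
  shows "\<bar>f y - f a\<bar> \<le> CARD('n) * M * norm (y - a)"
proof -
  obtain z where z: "f y - f a = (\<Sum>i\<in>UNIV. partial_deriv i f z * (y - a) $ i)"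
    using mvt_partial_deriv[OF assms(1)] by blast
  have "M \<ge> 0" using assms(2) abs_ge_zero order_trans by blast
  then have "\<bar>\<Sum>i\<in>UNIV. partial_deriv i f z * (y - a) $ i\<bar> \<le> (\<Sum>i\<in>(UNIV :: 'n set). M * norm (y - a))"
    by (intro order_trans[OF sum_abs] sum_mono) (auto simp: abs_mult intro!: mult_mono assms(2) component_le_norm_cart[of "y - a", simplified])
  then show ?thesis by (simp add: z)
qed

text \<open>The C^k norm enters only through upper bounds, so it is encoded as a predicate: all
  iterated partial derivatives up to order \<open>k\<close> are at most \<open>M\<close> in absolute
  value.\<close>

primrec deriv_bounded :: "nat \<Rightarrow> real \<Rightarrow> (real ^ 'n \<Rightarrow> real) \<Rightarrow> bool" where
  "deriv_bounded 0 M f \<longleftrightarrow> (\<forall>x. \<bar>f x\<bar> \<le> M)"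
| "deriv_bounded (Suc k) M f \<longleftrightarrow> (\<forall>x. \<bar>f x\<bar> \<le> M) \<and> (\<forall>i. deriv_bounded k M (partial_deriv i f))"

lemma deriv_bounded_0: "deriv_bounded k M f \<Longrightarrow> \<bar>f x\<bar> \<le> M"
  by (cases k) auto

lemma deriv_bounded_mono: "deriv_bounded k M f \<Longrightarrow> M \<le> N \<Longrightarrow> deriv_bounded k N f"
proof (induction k arbitrary: f)
  case (Suc k)
  then show ?case by (auto intro: order_trans)
qed (auto intro: order_trans)

lemma Cc_infty_deriv_bounded: "f \<in> Cc_infty \<Longrightarrow> \<exists>M\<ge>0. deriv_bounded k M f"
proof (induction k arbitrary: f)
  case 0
  then show ?case using Cc_infty_bounded[of f] by simp
next
  case (Suc k)
  obtain N where N: "N \<ge> 0" "\<And>x. \<bar>f x\<bar> \<le> N" using Cc_infty_bounded[OF Suc.prems] by blast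
  have "\<exists>M\<ge>0. deriv_bounded k M (partial_deriv i f)" for i
    by (intro Suc.IH Cc_infty_partial_deriv Suc.prems)
  then obtain M where M: "\<And>i. M i \<ge> 0" "\<And>i. deriv_bounded k (M i) (partial_deriv i f)" by metis
  define B where "B = N + (\<Sum>i\<in>UNIV. M i)"
  have "M i \<le> B" for i
    using member_le_sum[of i UNIV M] M(1) N(1) by (simp add: B_def)
  moreover have "0 \<le> (\<Sum>i\<in>UNIV. M i)" using M(1) by (simp add: sum_nonneg)
  ultimately have "B \<ge> N" "deriv_bounded k B (partial_deriv i f)" for i
    using M(2) deriv_bounded_mono unfolding B_def by (auto, blast)
  then show ?case using N by (intro exI[of _ B]) (auto intro: order_trans)
qed

lemma partial_deriv_translate:
  assumes "\<And>x. f differentiable (at x)"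
  shows "partial_deriv i (translate h f) = translate h (partial_deriv i f)"
proof
  fix x
  show "partial_deriv i (translate h f) x = translate h (partial_deriv i f) x"
    unfolding translate_def
    using frechet_derivative_at[OF frechet_derivative_translate[OF assms, of h x]]
    by (simp add: translate_def)
qed

lemma partial_deriv_diff:
  fixes f g :: "real ^ 'n \<Rightarrow> real"
  assumes "\<And>x. f differentiable (at x)" "\<And>x. g differentiable (at x)"
  shows "partial_deriv i (\<lambda>x. f x - g x) = (\<lambda>x. partial_deriv i f x - partial_deriv i g x)"
proof
  fix x
  show "partial_deriv i (\<lambda>x. f x - g x) x = partial_deriv i f x - partial_deriv i g x"
    using frechet_derivative_at[OF has_derivative_diff[OF assms[of x, THEN frechet_derivative_works[THEN iffD1]]]]
    by metis
qed

lemma deriv_bounded_translate: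
  "f \<in> Cc_infty \<Longrightarrow> deriv_bounded k M f \<Longrightarrow> deriv_bounded k M (translate h f)"
proof (induction k arbitrary: f)
  case 0
  then show ?case by (simp add: translate_def)
next
  case (Suc k)
  have "deriv_bounded k M (translate h (partial_deriv i f))" for i
    using Suc by (intro Suc.IH Cc_infty_partial_deriv) auto
  moreover have "\<bar>translate h f x\<bar> \<le> M" for x using Suc.prems(2) by (simp add: translate_def)
  ultimately show ?case
    unfolding deriv_bounded.simps partial_deriv_translate[OF Cc_infty_differentiable[OF Suc.prems(1)]]
    by blast
qed

text \<open>The mean value estimate at each order trades one derivative for a factor
  \<open>norm h\<close>. This turns a C^2 bound on \<open>L\<close> into a Lipschitz bound along
  translations.\<close>

lemma deriv_bounded_translate_diff:
  fixes f :: "real ^ 'n \<Rightarrow> real" and M :: real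
  shows "f \<in> Cc_infty \<Longrightarrow> deriv_bounded (Suc k) M f \<Longrightarrow>
    deriv_bounded k (CARD('n) * M * norm h) (\<lambda>x. translate h f x - f x)"
proof (induction k arbitrary: f)
  case 0
  then have "\<bar>f (x + h) - f x\<bar> \<le> CARD('n) * M * norm h" for x
    using partial_deriv_lipschitz[OF Cc_infty_differentiable, of f M "x + h" x] by simp
  then show ?case by (simp add: translate_def)
next
  case (Suc k)
  have bd: "\<bar>translate h f x - f x\<bar> \<le> CARD('n) * M * norm h" for x
    using partial_deriv_lipschitz[OF Cc_infty_differentiable, of f M "x + h" x] Suc.prems
    by (simp add: translate_def)
  have "deriv_bounded k (CARD('n) * M * norm h) (partial_deriv i (\<lambda>x. translate h f x - f x))" for i
  proof -
    have "partial_deriv i (\<lambda>x. translate h f x - f x)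
        = (\<lambda>x. translate h (partial_deriv i f) x - partial_deriv i f x)"
      using partial_deriv_diff[OF Cc_infty_differentiable[OF Cc_infty_translate[OF Suc.prems(1)]]
          Cc_infty_differentiable[OF Suc.prems(1)], where i = i]
        partial_deriv_translate[OF Cc_infty_differentiable[OF Suc.prems(1)], where i = i and h = h]
      by (simp add: fun_eq_iff)
    moreover have "deriv_bounded k (CARD('n) * M * norm h)
        (\<lambda>x. translate h (partial_deriv i f) x - partial_deriv i f x)"
      using Suc.prems by (intro Suc.IH Cc_infty_partial_deriv) auto
    ultimately show ?thesis by metis
  qed
  then show ?case unfolding deriv_bounded.simps using bd by blast
qed

text \<open>Two uses of the mean value estimate, each summing over the coordinates, produce the
  factor d^2; sharpness of the constant is irrelevant.\<close>

lemma taylor2_bound: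
  fixes f :: "real ^ 'n \<Rightarrow> real" and M :: real
  assumes f: "f \<in> Cc_infty" and M: "deriv_bounded 2 M f"
  shows "\<bar>f y - f a - (\<Sum>i\<in>UNIV. partial_deriv i f a * (y - a) $ i)\<bar>
    \<le> CARD('n)\<^sup>2 * M * (norm (y - a))\<^sup>2"
proof -
  have M2: "\<bar>partial_deriv j (partial_deriv i f) x\<bar> \<le> M" for i j x
    using M by (simp add: numeral_2_eq_2)
  then have "M \<ge> 0" using abs_ge_zero order_trans by blast
  obtain z where z: "norm (z - a) \<le> norm (y - a)"
      "f y - f a = (\<Sum>i\<in>UNIV. partial_deriv i f z * (y - a) $ i)"
    using mvt_partial_deriv[OF Cc_infty_differentiable[OF f]] by blast
  have lip: "\<bar>partial_deriv i f z - partial_deriv i f a\<bar> \<le> CARD('n) * M * norm (y - a)" for i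
  proof -
    have "\<bar>partial_deriv i f z - partial_deriv i f a\<bar> \<le> CARD('n) * M * norm (z - a)"
      by (intro partial_deriv_lipschitz Cc_infty_differentiable Cc_infty_partial_deriv f M2)
    also have "\<dots> \<le> CARD('n) * M * norm (y - a)"
      using z(1) \<open>M \<ge> 0\<close> by (intro mult_left_mono) auto
    finally show ?thesis .
  qed
  have "f y - f a - (\<Sum>i\<in>UNIV. partial_deriv i f a * (y - a) $ i)
      = (\<Sum>i\<in>UNIV. (partial_deriv i f z - partial_deriv i f a) * (y - a) $ i)"
    unfolding z(2) by (simp only: left_diff_distrib sum_subtractf)
  also have "\<bar>\<dots>\<bar> \<le> (\<Sum>i\<in>(UNIV :: 'n set). (CARD('n) * M * norm (y - a)) * norm (y - a))"
    using \<open>M \<ge> 0\<close>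
    by (intro order_trans[OF sum_abs] sum_mono)
      (auto simp only: abs_mult intro!: mult_mono lip component_le_norm_cart; simp)
  also have "\<dots> = CARD('n)\<^sup>2 * M * (norm (y - a))\<^sup>2" by (simp add: power2_eq_square)
  finally show ?thesis .
qed

section \<open>Operators with the positive maximum principle\<close>

locale pmp_operator =
  fixes L :: "(real ^ 'n \<Rightarrow> real) \<Rightarrow> (real ^ 'n \<Rightarrow> real)"
  assumes L_continuous: "f \<in> Cc_infty \<Longrightarrow> continuous_on UNIV (L f)"
    and L_linear: "linear_operator_on Cc_infty L"
    and L_pmp: "positive_maximum_principle L"
begin

lemma L_add: "f \<in> Cc_infty \<Longrightarrow> g \<in> Cc_infty \<Longrightarrow> L (\<lambda>x. f x + g x) a = L f a + L g a"
  using L_linear by (simp add: linear_operator_on_def)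

lemma L_cmult: "f \<in> Cc_infty \<Longrightarrow> L (\<lambda>x. c * f x) a = c * L f a"
  using L_linear by (simp add: linear_operator_on_def)

lemma L_diff:
  assumes f: "f \<in> Cc_infty" and g: "g \<in> Cc_infty" shows "L (\<lambda>x. f x - g x) a = L f a - L g a"
  using L_add[OF f Cc_infty_cmult[OF g], of "-1"] L_cmult[OF g, of "-1"] by simp

lemma L_zero: "L (\<lambda>x. 0) a = 0"
proof -
  have "(\<lambda>x. 0) \<in> Cc_infty" by (auto intro!: Cc_inftyI[of _ 0] C_k_const)
  from L_cmult[OF this, of 0] show ?thesis by simp
qed

lemma L_sum:
  assumes "finite I" "\<And>i. i \<in> I \<Longrightarrow> F i \<in> Cc_infty"
  shows "L (\<lambda>x. \<Sum>i\<in>I. F i x) a = (\<Sum>i\<in>I. L (F i) a)"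
  using assms
proof (induction I rule: finite_induct)
  case (insert i I)
  then show ?case using L_add[of "F i" "\<lambda>x. \<Sum>i\<in>I. F i x" a] by (simp add: Cc_infty_sum)
qed (simp add: L_zero)

lemma L_nonpos_at_max:
  assumes "f \<in> Cc_infty" "\<And>x. f x \<le> f a" "f a \<ge> 0" shows "L f a \<le> 0"
proof -
  have "(SUP x. f x) = f a" by (rule cSup_eq_maximum) (use assms in auto)
  then show ?thesis using L_pmp assms by (auto simp: positive_maximum_principle_def)
qed

lemma L_nonneg_at_min:
  assumes f: "f \<in> Cc_infty" and "\<And>x. f x \<ge> 0" "f a = 0" shows "L f a \<ge> 0"
  using L_nonpos_at_max[OF Cc_infty_cmult[OF f, of "-1"], of a] L_cmult[OF f, of "-1" a] assms by simp

text \<open>The function \<open>f - \<phi> \<cdot> (P - M)\<close>, where \<open>P\<close> is the second order Taylor polynomial of \<open>f\<close> at \<open>a\<close> with the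
  quadratic term replaced by its upper bound, attains its maximum \<open>M\<close> at \<open>a\<close>.\<close>

lemma L_le_deriv_bound:
  fixes f \<phi> :: "real ^ 'n \<Rightarrow> real" and a :: "real ^ 'n"
  assumes f: "f \<in> Cc_infty" and M: "deriv_bounded 2 M f"
    and \<phi>: "\<phi> \<in> Cc_infty" "\<And>x. 0 \<le> \<phi> x" "\<And>x. \<phi> x \<le> 1" "\<phi> a = 1"
    and R: "norm a \<le> R" and Q: "\<bar>L \<phi> a\<bar> \<le> Q" "\<And>i. \<bar>L (\<lambda>x. x $ i * \<phi> x) a\<bar> \<le> Q"
      "\<And>i. \<bar>L (\<lambda>x. x $ i * x $ i * \<phi> x) a\<bar> \<le> Q"
  defines "n \<equiv> real CARD('n)"
  shows "L f a \<le> (2 + n * R + n * (n\<^sup>2 * R\<^sup>2) + n * (1 + 2 * n\<^sup>2 * R) + n * n\<^sup>2) * Q * M"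
proof -
  have "M \<ge> 0" using deriv_bounded_0[OF M, of a] by linarith
  have "Q \<ge> 0" using Q(1) by linarith
  have "R \<ge> 0" using R norm_ge_zero order_trans by blast
  define D where "D i = partial_deriv i f a" for i
  define B where "B = n\<^sup>2 * M"
  have "B \<ge> 0" using \<open>M \<ge> 0\<close> by (simp add: B_def)
  \<comment> \<open>\<open>c0\<close>, \<open>c1 i\<close> and \<open>- B\<close> are the
    coefficients of 1, x_i and x_i^2 when M - f(a) - D.(x - a) - B |x - a|^2 is expanded about the
    origin. Thus \<open>L\<close> only meets cut-off monomials that are the same for every
    \<open>a\<close>.\<close>
  define c0 where "c0 = M - f a + (\<Sum>i\<in>UNIV. D i * a $ i) - (\<Sum>i\<in>UNIV. B * (a $ i * a $ i))"
  define c1 where "c1 i = 2 * B * a $ i - D i" for i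
  define F where "F x = f x + (c0 * \<phi> x + (\<Sum>i\<in>UNIV. c1 i * (x $ i * \<phi> x) + (- B) * (x $ i * x $ i * \<phi> x)))" for x
  have mem: "(\<lambda>x. x $ i * \<phi> x) \<in> Cc_infty" "(\<lambda>x. x $ i * x $ i * \<phi> x) \<in> Cc_infty" for i
    by (intro Cc_infty_mult[OF _ \<phi>(1)] C_k_mult C_k_component)+
  note mem' = Cc_infty_cmult[OF \<phi>(1)] Cc_infty_cmult[OF mem(1)] Cc_infty_cmult[OF mem(2)]
  have memi: "(\<lambda>x. c1 i * (x $ i * \<phi> x) + (- B) * (x $ i * x $ i * \<phi> x)) \<in> Cc_infty" for i
    by (rule Cc_infty_add[OF mem'(2,3)])
  note mems = Cc_infty_sum[OF finite memi, where I = UNIV]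
  have F: "F \<in> Cc_infty"
    unfolding F_def[abs_def] by (rule Cc_infty_add[OF f Cc_infty_add[OF mem'(1) mems]])
  have LF: "L F a = L f a + (c0 * L \<phi> a + (\<Sum>i\<in>UNIV. c1 i * L (\<lambda>x. x $ i * \<phi> x) a + (- B) * L (\<lambda>x. x $ i * x $ i * \<phi> x) a))"
    unfolding F_def[abs_def]
    by (simp only: L_add[OF f Cc_infty_add[OF mem'(1) mems]] L_add[OF mem'(1) mems] L_cmult[OF \<phi>(1)]
        L_sum[OF finite memi, where I = UNIV] L_add[OF mem'(2,3)] L_cmult[OF mem(1)] L_cmult[OF mem(2)])
  have Feq: "F x = f x + \<phi> x * (M - f a - (\<Sum>i\<in>UNIV. D i * (x - a) $ i) - B * (norm (x - a))\<^sup>2)" for x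
  proof -
    have norm2: "(norm (x - a))\<^sup>2 = (\<Sum>i\<in>UNIV. (x $ i - a $ i)\<^sup>2)"
      by (simp add: norm_vec_def L2_set_def sum_nonneg)
    show ?thesis
      unfolding F_def c0_def c1_def norm2
      by (simp add: algebra_simps sum_distrib_left sum_subtractf sum.distrib power2_eq_square)
  qed
  have "F x \<le> M" for x
  proof -
    have "f x \<le> f a + (\<Sum>i\<in>UNIV. D i * (x - a) $ i) + B * (norm (x - a))\<^sup>2"
      using taylor2_bound[OF f M, of x a] by (simp add: D_def B_def n_def)
    \<comment> \<open>By the Taylor bound the bracket in \<open>Feq\<close> is at most M - f(x), so
      \<open>F x\<close> lies below a convex combination, with weight \<open>\<phi> x\<close>, of
      f(x) and M.\<close>
    then have "F x \<le> f x + \<phi> x * (M - f x)"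
      unfolding Feq by (intro add_left_mono mult_left_mono \<phi>) auto
    also have "\<dots> = f x * (1 - \<phi> x) + \<phi> x * M" by (simp add: algebra_simps)
    also have "\<dots> \<le> M * (1 - \<phi> x) + \<phi> x * M"
      using deriv_bounded_0[OF M, of x] by (intro add_right_mono mult_right_mono) (auto simp: \<phi>)
    finally show ?thesis by (simp add: algebra_simps)
  qed
  moreover have "F a = M" using \<phi>(4) by (simp add: Feq)
  ultimately have "L F a \<le> 0" using F \<open>M \<ge> 0\<close> by (intro L_nonpos_at_max) auto
  then have "L f a \<le> - (c0 * L \<phi> a) + (\<Sum>i\<in>UNIV. - (c1 i * L (\<lambda>x. x $ i * \<phi> x) a) + B * L (\<lambda>x. x $ i * x $ i * \<phi> x) a)"
    unfolding LF by (simp add: sum_subtractf)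
  \<comment> \<open>All coefficients are multiples of M: |c0| \<le> (2 + n R + n^3 R^2) M, |c1 i|
    \<le> (1 + 2 n^2 R) M and B = n^2 M. Multiplying by Q and summing over i gives the constant of
    the statement.\<close>
  also have "\<dots> \<le> (2 + n * R + n * (n\<^sup>2 * R\<^sup>2)) * M * Q + (\<Sum>i\<in>(UNIV :: 'n set). (1 + 2 * n\<^sup>2 * R) * M * Q + n\<^sup>2 * M * Q)"
  proof (intro add_mono sum_mono)
    have ai: "\<bar>a $ i\<bar> \<le> R" for i using component_le_norm_cart[of a i] R by linarith
    have Di: "\<bar>D i\<bar> \<le> M" for i using M by (simp add: D_def numeral_2_eq_2)
    have neg: "- (x * y) \<le> u * v" if "\<bar>x\<bar> \<le> u" "\<bar>y\<bar> \<le> v" for x y u v :: real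
    proof -
      have "\<bar>x * y\<bar> \<le> u * v" unfolding abs_mult using that by (intro mult_mono) auto
      then show ?thesis by linarith
    qed
    have "\<bar>D i * a $ i\<bar> \<le> M * R" for i
      unfolding abs_mult using ai Di \<open>M \<ge> 0\<close> by (intro mult_mono) auto
    then have s1: "\<bar>\<Sum>i\<in>UNIV. D i * a $ i\<bar> \<le> n * (M * R)"
      using sum_norm_bound[of UNIV "\<lambda>i. D i * a $ i" "M * R"] by (simp add: n_def)
    have "\<bar>B * (a $ i * a $ i)\<bar> \<le> B * (R * R)" for i
      unfolding abs_mult using ai \<open>B \<ge> 0\<close> \<open>R \<ge> 0\<close> by (intro mult_mono) auto
    then have s2: "\<bar>\<Sum>i\<in>UNIV. B * (a $ i * a $ i)\<bar> \<le> n * (B * (R * R))"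
      using sum_norm_bound[of UNIV "\<lambda>i. B * (a $ i * a $ i)" "B * (R * R)"] by (simp add: n_def)
    have "\<bar>c0\<bar> \<le> M + M + n * (M * R) + n * (B * (R * R))"
      using s1 s2 deriv_bounded_0[OF M, of a] \<open>M \<ge> 0\<close> unfolding c0_def by linarith
    also have "\<dots> = (2 + n * R + n * (n\<^sup>2 * R\<^sup>2)) * M"
      by (simp add: B_def algebra_simps power2_eq_square)
    finally show "- (c0 * L \<phi> a) \<le> (2 + n * R + n * (n\<^sup>2 * R\<^sup>2)) * M * Q"
      by (rule neg) (rule Q(1))
    fix i
    have "\<bar>2 * B * a $ i\<bar> \<le> 2 * B * R"
      unfolding abs_mult using ai \<open>B \<ge> 0\<close> by (intro mult_mono) auto
    then have "\<bar>c1 i\<bar> \<le> (1 + 2 * n\<^sup>2 * R) * M"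
      using Di[of i] unfolding c1_def B_def by (simp add: algebra_simps)
    then show "- (c1 i * L (\<lambda>x. x $ i * \<phi> x) a) \<le> (1 + 2 * n\<^sup>2 * R) * M * Q"
      by (rule neg) (rule Q(2))
    show "B * L (\<lambda>x. x $ i * x $ i * \<phi> x) a \<le> n\<^sup>2 * M * Q"
      unfolding B_def[symmetric] using Q(3)[of i] \<open>B \<ge> 0\<close> by (intro mult_left_mono) auto
  qed
  also have "\<dots> = (2 + n * R + n * (n\<^sup>2 * R\<^sup>2) + n * (1 + 2 * n\<^sup>2 * R) + n * n\<^sup>2) * Q * M"
    by (simp add: n_def algebra_simps)
  finally show ?thesis .
qed

lemma L_bounded_on_compact:
  assumes "compact K" "f \<in> Cc_infty" shows "\<exists>Q\<ge>0. \<forall>a\<in>K. \<bar>L f a\<bar> \<le> Q"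
proof -
  have "bounded (L f ` K)"
    using L_continuous[OF assms(2)] assms(1)
    by (intro compact_imp_bounded compact_continuous_image) (auto intro: continuous_on_subset)
  then show ?thesis unfolding bounded_pos by (auto intro: less_imp_le)
qed

text \<open>One bump equal to 1 on a ball containing K serves every \<open>a\<close> in K, so
  finitely many functions, each with \<open>L\<close> bounded on K, determine C. Applying the upper
  bound to \<open>f\<close> and to its negative makes it two-sided.\<close>

lemma L_deriv_bound:
  assumes K: "compact K"
  shows "\<exists>C\<ge>0. \<forall>a\<in>K. \<forall>f\<in>Cc_infty. \<forall>M. deriv_bounded 2 M f \<longrightarrow> \<bar>L f a\<bar> \<le> C * M"
proof -
  obtain R where R: "R > 0" "\<forall>a\<in>K. norm a \<le> R"
    using compact_imp_bounded[OF K] unfolding bounded_pos by blast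
  obtain \<phi> :: "real ^ 'n \<Rightarrow> real" where \<phi>: "\<phi> \<in> Cc_infty" "\<And>x. 0 \<le> \<phi> x" "\<And>x. \<phi> x \<le> 1"
      "\<And>x. norm x \<le> R \<Longrightarrow> \<phi> x = 1"
    using bump_exists[OF R(1)] by metis
  have mem: "(\<lambda>x. x $ i * \<phi> x) \<in> Cc_infty" "(\<lambda>x. x $ i * x $ i * \<phi> x) \<in> Cc_infty" for i
    by (intro Cc_infty_mult[OF _ \<phi>(1)] C_k_mult C_k_component)+
  obtain Q0 where Q0: "Q0 \<ge> 0" "\<forall>a\<in>K. \<bar>L \<phi> a\<bar> \<le> Q0"
    using L_bounded_on_compact[OF K \<phi>(1)] by blast
  obtain Q1 where Q1: "\<And>i. Q1 i \<ge> 0" "\<And>i. \<forall>a\<in>K. \<bar>L (\<lambda>x. x $ i * \<phi> x) a\<bar> \<le> Q1 i"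
    using L_bounded_on_compact[OF K mem(1)] by metis
  obtain Q2 where Q2: "\<And>i. Q2 i \<ge> 0" "\<And>i. \<forall>a\<in>K. \<bar>L (\<lambda>x. x $ i * x $ i * \<phi> x) a\<bar> \<le> Q2 i"
    using L_bounded_on_compact[OF K mem(2)] by metis
  define Q where "Q = Q0 + (\<Sum>i\<in>UNIV. Q1 i) + (\<Sum>i\<in>UNIV. Q2 i)"
  have s: "0 \<le> (\<Sum>i\<in>UNIV. Q1 i)" "0 \<le> (\<Sum>i\<in>UNIV. Q2 i)" using Q1 Q2 by (simp_all add: sum_nonneg)
  have Q: "Q0 \<le> Q" "Q1 i \<le> Q" "Q2 i \<le> Q" for i
    using member_le_sum[of i UNIV Q1] member_le_sum[of i UNIV Q2] Q1(1) Q2(1) Q0(1) s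
    by (simp_all add: Q_def)
  define n where "n = real CARD('n)"
  define C where "C = (2 + n * R + n * (n\<^sup>2 * R\<^sup>2) + n * (1 + 2 * n\<^sup>2 * R) + n * n\<^sup>2) * Q"
  have le: "L f a \<le> C * M" if "a \<in> K" "f \<in> Cc_infty" "deriv_bounded 2 M f" for a f M
  proof -
    have "norm a \<le> R" "\<bar>L \<phi> a\<bar> \<le> Q" using R(2) Q0(2) Q(1) that(1) by force+
    moreover have "\<bar>L (\<lambda>x. x $ i * \<phi> x) a\<bar> \<le> Q" "\<bar>L (\<lambda>x. x $ i * x $ i * \<phi> x) a\<bar> \<le> Q" for i
      using Q1(2)[of i] Q2(2)[of i] Q(2,3)[of i] that(1) by force+
    ultimately show ?thesis
      unfolding C_def n_def by (intro L_le_deriv_bound[OF that(2,3) \<phi>(1-3)] \<phi>(4))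
  qed
  have neg: "deriv_bounded k M (\<lambda>x. - 1 * f x)" if "f \<in> Cc_infty" "deriv_bounded k M f" for k M and f :: "real ^ 'n \<Rightarrow> real"
    using that
  proof (induction k arbitrary: f)
    case (Suc k)
    have "partial_deriv i (\<lambda>x. - 1 * f x) = (\<lambda>x. - 1 * partial_deriv i f x)" for i
      using frechet_derivative_at[OF has_derivative_mult_right[OF
            frechet_derivative_works[THEN iffD1, OF Cc_infty_differentiable[OF Suc.prems(1)]], of "-1"]]
      by metis
    then show ?case
      using Suc Cc_infty_partial_deriv[OF Suc.prems(1)] by simp
  qed simp
  show ?thesis
  proof (intro exI[of _ C] conjI ballI allI impI)
    show "C \<ge> 0" using R Q(1) Q0(1) by (simp add: C_def n_def)
    fix a M and f :: "real ^ 'n \<Rightarrow> real"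
    assume *: "a \<in> K" "f \<in> Cc_infty" "deriv_bounded 2 M f"
    show "\<bar>L f a\<bar> \<le> C * M"
      using le[OF *] le[OF *(1) Cc_infty_cmult[OF *(2)] neg[OF *(2,3)]] L_cmult[OF *(2), of "-1"]
      by simp
  qed
qed

section \<open>Bounds, Lipschitz dependence and decay of \<open>L\<close> on translates\<close>

lemma L_translate_bounded:
  assumes K: "compact K" and f: "f \<in> Cc_infty"
  shows "\<exists>M\<ge>0. \<forall>a\<in>K. \<forall>h. \<bar>L (translate h f) a\<bar> \<le> M"
proof -
  obtain C where C: "C \<ge> 0" "\<forall>a\<in>K. \<forall>f\<in>Cc_infty. \<forall>M. deriv_bounded 2 M f \<longrightarrow> \<bar>L f a\<bar> \<le> C * M"
    using L_deriv_bound[OF K] by blast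
  obtain M where M: "M \<ge> 0" "deriv_bounded 2 M f" using Cc_infty_deriv_bounded[OF f] by blast
  show ?thesis
    using C M by (intro exI[of _ "C * M"]) (auto intro!: Cc_infty_translate deriv_bounded_translate f)
qed

text \<open>The C^2 bound is applied to the increment of a translate, whose C^2 norm is at most a
  constant times \<open>norm k\<close> by a bound on three derivatives of \<open>f\<close>.\<close>

lemma L_translate_lipschitz:
  assumes K: "compact K" and f: "f \<in> Cc_infty"
  shows "\<exists>C\<ge>0. \<forall>a\<in>K. \<forall>h k. \<bar>L (translate (h + k) f) a - L (translate h f) a\<bar> \<le> C * norm k"
proof -
  obtain C where C: "C \<ge> 0" "\<forall>a\<in>K. \<forall>f\<in>Cc_infty. \<forall>M. deriv_bounded 2 M f \<longrightarrow> \<bar>L f a\<bar> \<le> C * M"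
    using L_deriv_bound[OF K] by blast
  obtain M where M: "M \<ge> 0" "deriv_bounded (Suc 2) M f" using Cc_infty_deriv_bounded[OF f] by blast
  have "\<bar>L (translate (h + k) f) a - L (translate h f) a\<bar> \<le> C * (CARD('n) * M * norm k)" if "a \<in> K" for a h k
  proof -
    define g where "g = translate h f"
    have g: "g \<in> Cc_infty" unfolding g_def by (rule Cc_infty_translate[OF f])
    have "translate (h + k) f = translate k g" by (simp add: g_def translate_def ac_simps)
    moreover have "deriv_bounded 2 (CARD('n) * M * norm k) (\<lambda>x. translate k g x - g x)"
      using deriv_bounded_translate[OF f M(2)] by (intro deriv_bounded_translate_diff g) (simp only: g_def)
    then have "\<bar>L (\<lambda>x. translate k g x - g x) a\<bar> \<le> C * (CARD('n) * M * norm k)"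
      using C(2) that Cc_infty_diff[OF Cc_infty_translate[OF g] g] by blast
    ultimately show ?thesis
      using L_diff[OF Cc_infty_translate[OF g] g] by (simp add: g_def)
  qed
  then show ?thesis
    using C M by (intro exI[of _ "C * (CARD('n) * M)"]) (auto simp: mult.assoc)
qed

text \<open>If \<open>L (translate h \<psi>) a\<close> stayed above \<open>\<delta>\<close> for arbitrarily large \<open>h\<close>, then adding up many translates of
  \<open>\<psi>\<close> with disjoint supports, together with a bump at \<open>a\<close>, would contradict the maximum principle.\<close>

lemma L_translate_bump_small:
  fixes \<psi> :: "real ^ 'n \<Rightarrow> real"
  assumes \<psi>: "\<psi> \<in> Cc_infty" "\<And>x. 0 \<le> \<psi> x" "\<And>x. \<psi> x \<le> 1" and "\<delta> > 0"
  shows "\<exists>r. \<forall>h. norm h \<ge> r \<longrightarrow> L (translate h \<psi>) a < \<delta>"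
proof (rule ccontr)
  assume "\<not> ?thesis"
  then have large: "\<And>r. \<exists>h. norm h \<ge> r \<and> L (translate h \<psi>) a \<ge> \<delta>" by (auto simp: not_less)
  obtain s where s: "\<And>x. norm x \<ge> s \<Longrightarrow> \<psi> x = 0" using Cc_infty_vanishes[OF \<psi>(1)] by blast
  obtain \<phi> :: "real ^ 'n \<Rightarrow> real" where \<phi>: "\<phi> \<in> Cc_infty" "\<And>x. 0 \<le> \<phi> x" "\<And>x. \<phi> x \<le> 1"
      "\<And>x. norm x \<le> norm a + 1 \<Longrightarrow> \<phi> x = 1"
    using bump_exists[of "norm a + 1"] by (metis add_nonneg_pos norm_ge_zero zero_less_one)
  have "\<exists>F\<in>Cc_infty. (\<forall>x. \<phi> x \<le> F x \<and> F x \<le> 1) \<and> F a = 1 \<and> L F a \<ge> L \<phi> a + N * \<delta>" for N :: nat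
  proof (induction N)
    case 0
    show ?case using \<phi> by (intro bexI[of _ \<phi>]) auto
  next
    case (Suc N)
    then obtain F where F: "F \<in> Cc_infty" "\<And>x. \<phi> x \<le> F x" "\<And>x. F x \<le> 1" "F a = 1"
        "L F a \<ge> L \<phi> a + N * \<delta>" by blast
    obtain u where u: "\<And>x. norm x \<ge> u \<Longrightarrow> F x = 0" using Cc_infty_vanishes[OF F(1)] by blast
    \<comment> \<open>At this distance the two supports are disjoint, so the sum stays at most 1. As
      \<open>F a = 1\<close> is nonzero, the new translate vanishes at \<open>a\<close>, and the
      value at the maximum is kept.\<close>
    obtain h where h: "norm h \<ge> u + s" "L (translate h \<psi>) a \<ge> \<delta>" using large by blast
    have disj: "F x = 0 \<or> translate h \<psi> x = 0" for x
    proof (cases "norm x \<ge> u")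
      case False
      have "norm (x + h) \<ge> s" using h(1) False norm_diff_ineq[of h x] by (simp add: add.commute)
      then show ?thesis using s by (simp add: translate_def)
    qed (use u in auto)
    let ?G = "\<lambda>x. F x + translate h \<psi> x"
    have "\<phi> x \<le> ?G x" for x using F(2)[of x] \<psi>(2)[of "x + h"] by (simp add: translate_def)
    moreover have "?G x \<le> 1" for x using disj[of x] F(3)[of x] \<psi>(3)[of "x + h"] by (auto simp: translate_def)
    moreover have "?G a = 1" using disj[of a] F(4) by auto
    moreover have "L ?G a \<ge> L \<phi> a + Suc N * \<delta>"
      using F(5) h(2) L_add[OF F(1) Cc_infty_translate[OF \<psi>(1)]] by (simp add: algebra_simps)
    ultimately show ?case
      using Cc_infty_add[OF F(1) Cc_infty_translate[OF \<psi>(1)]] by (intro bexI[of _ ?G]) auto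
  qed
  then have "L \<phi> a + N * \<delta> \<le> 0" for N :: nat
    using L_nonpos_at_max[of _ a] by (metis order_trans zero_le_one)
  moreover obtain N :: nat where "N * \<delta> > - L \<phi> a" using ex_less_of_nat_mult[OF \<open>\<delta> > 0\<close>] by blast
  ultimately show False by (smt (verit))
qed

text \<open>A bump dominates: |f| \<le> M \<psi>. For large h both translates vanish at
  \<open>a\<close>, so M \<psi> + f and M \<psi> - f, translated by h, have minimum 0 there, and the
  maximum principle bounds |L f| by M times L \<psi>, which is eventually small.\<close>

lemma L_translate_tendsto_0:
  fixes f :: "real ^ 'n \<Rightarrow> real"
  assumes f: "f \<in> Cc_infty"
  shows "((\<lambda>h. L (translate h f) a) \<longlongrightarrow> 0) at_infinity"
proof -
  obtain s where s: "\<And>x. norm x \<ge> s \<Longrightarrow> f x = 0" using Cc_infty_vanishes[OF f] by blast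
  define s' where "s' = max s 1"
  have "s' > 0" by (simp add: s'_def)
  then obtain \<psi> :: "real ^ 'n \<Rightarrow> real" where \<psi>: "\<psi> \<in> Cc_infty" "\<And>x. 0 \<le> \<psi> x" "\<And>x. \<psi> x \<le> 1"
      "\<And>x. norm x \<le> s' \<Longrightarrow> \<psi> x = 1" "\<And>x. norm x \<ge> 2 * s' \<Longrightarrow> \<psi> x = 0"
    using bump_exists[of s'] by metis
  obtain M where M: "M \<ge> 0" "\<And>x. \<bar>f x\<bar> \<le> M" using Cc_infty_bounded[OF f] by blast
  have fle: "\<bar>f x\<bar> \<le> M * \<psi> x" for x
    using M s[of x] \<psi>(2)[of x] \<psi>(4)[of x] by (cases "norm x \<ge> s") (auto simp: s'_def)
  have bd: "\<bar>L (translate h f) a\<bar> \<le> M * L (translate h \<psi>) a" if "norm h \<ge> 2 * s' + norm a" for h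
  proof -
    have "norm (a + h) \<ge> 2 * s'" using that norm_diff_ineq[of h a] by (simp add: add.commute)
    then have z: "translate h \<psi> a = 0" using \<psi>(5) by (simp add: translate_def)
    have z': "translate h f a = 0" using z fle[of "a + h"] by (simp add: translate_def)
    note t = Cc_infty_translate[OF f, of h] Cc_infty_translate[OF \<psi>(1), of h]
    have "\<bar>translate h f x\<bar> \<le> M * translate h \<psi> x" for x using fle by (simp add: translate_def)
    then have nn: "0 \<le> M * translate h \<psi> x - translate h f x" "0 \<le> M * translate h \<psi> x + translate h f x" for x
      by (smt (verit))+
    have "0 \<le> L (\<lambda>x. M * translate h \<psi> x - translate h f x) a"
      using z z' nn by (intro L_nonneg_at_min Cc_infty_diff Cc_infty_cmult t) auto
    moreover have "0 \<le> L (\<lambda>x. M * translate h \<psi> x + translate h f x) a"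
      using z z' nn by (intro L_nonneg_at_min Cc_infty_add Cc_infty_cmult t) auto
    ultimately show ?thesis
      using L_diff[OF Cc_infty_cmult[OF t(2)] t(1)] L_add[OF Cc_infty_cmult[OF t(2)] t(1)] L_cmult[OF t(2)]
      by (simp add: abs_le_iff)
  qed
  show ?thesis
    unfolding tendsto_iff eventually_at_infinity
  proof (intro allI impI)
    fix e :: real assume "e > 0"
    \<comment> \<open>The denominator is M + 1 because M may be 0.\<close>
    then obtain r where r: "\<And>h. norm h \<ge> r \<Longrightarrow> L (translate h \<psi>) a < e / (M + 1)"
      using L_translate_bump_small[OF \<psi>(1-3), of "e / (M + 1)" a] M(1) by auto
    have "dist (L (translate h f) a) 0 < e" if "norm h \<ge> max r (2 * s' + norm a)" for h
    proof -
      have "\<bar>L (translate h f) a\<bar> \<le> M * L (translate h \<psi>) a" using that by (intro bd) auto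
      also have "\<dots> \<le> M * (e / (M + 1))" using that M(1) r[of h] by (intro mult_left_mono) auto
      also have "\<dots> < e" using \<open>e > 0\<close> M(1) by (simp add: field_simps)
      finally show ?thesis by simp
    qed
    then show "\<exists>b. \<forall>x. b \<le> norm x \<longrightarrow> dist (L (translate x f) a) 0 < e" by blast
  qed
qed

lemma frozen_C_zero:
  assumes f: "f \<in> Cc_infty" shows "frozen L a f \<in> C_zero"
proof -
  obtain C where C: "C \<ge> 0" "\<And>h k. \<bar>L (translate (h + k) f) a - L (translate h f) a\<bar> \<le> C * norm k"
    using L_translate_lipschitz[OF _ f, of "{a}"] by auto
  have "C-lipschitz_on UNIV (frozen L a f)"
  proof (rule lipschitz_onI)
    show "dist (frozen L a f x) (frozen L a f y) \<le> C * dist x y" for x y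
      using C(2)[of "y - a" "x - y"] by (simp add: frozen_def dist_norm)
  qed (rule C(1))
  then have "continuous_on UNIV (frozen L a f)" by (rule lipschitz_on_continuous_on)
  moreover have "filterlim (\<lambda>b. b - a) at_infinity at_infinity"
    using tendsto_add_filterlim_at_infinity'[OF filterlim_ident tendsto_const[of "- a"]] by simp
  then have "(frozen L a f \<longlongrightarrow> 0) at_infinity"
    unfolding frozen_def using filterlim_compose[OF L_translate_tendsto_0[OF f]] by blast
  ultimately show ?thesis by (simp add: C_zero_def)
qed

end

section \<open>Feller semi-groups\<close>

lemma C_zero_continuous: "f \<in> C_zero \<Longrightarrow> continuous_on UNIV f"
  by (simp add: C_zero_def)

lemma C_zero_small:
  assumes "f \<in> C_zero" "e > 0"
  shows "\<exists>r. \<forall>x. norm x \<ge> r \<longrightarrow> \<bar>f x\<bar> < e"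
proof -
  have "\<forall>\<^sub>F x in at_infinity. dist (f x) 0 < e"
    using assms by (intro tendstoD) (auto simp: C_zero_def)
  then show ?thesis by (simp add: eventually_at_infinity)
qed

lemma C_zeroI:
  assumes "continuous_on UNIV f" "\<And>e. e > 0 \<Longrightarrow> \<exists>r. \<forall>x. norm x \<ge> r \<longrightarrow> \<bar>f x\<bar> \<le> e"
  shows "f \<in> C_zero"
proof -
  have "\<exists>r. \<forall>x. norm x \<ge> r \<longrightarrow> dist (f x) 0 < e" if "e > 0" for e
    using assms(2)[of "e / 2"] that by (force simp: field_simps)
  then show ?thesis using assms(1) by (simp add: C_zero_def tendsto_iff eventually_at_infinity)
qed

lemma C_zero_bounded:
  assumes f: "f \<in> C_zero" shows "\<exists>M\<ge>0. \<forall>x. \<bar>f x\<bar> \<le> M"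
proof -
  obtain r where r: "\<And>x. norm x \<ge> r \<Longrightarrow> \<bar>f x\<bar> < 1" using C_zero_small[OF f, of 1] by auto
  have "bounded (f ` cball 0 r)"
    using C_zero_continuous[OF f]
    by (intro compact_imp_bounded compact_continuous_image) (auto intro: continuous_on_subset)
  then obtain M where M: "M > 0" "\<forall>y\<in>f ` cball 0 r. norm y \<le> M" unfolding bounded_pos by blast
  have "\<bar>f x\<bar> \<le> max M 1" for x
    using M(2) r[of x] by (cases "norm x \<le> r") (force simp: le_max_iff_disj)+
  then show ?thesis by (intro exI[of _ "max M 1"]) auto
qed

lemma C_zero_add: "f \<in> C_zero \<Longrightarrow> g \<in> C_zero \<Longrightarrow> (\<lambda>x. f x + g x) \<in> C_zero"
  unfolding C_zero_def using tendsto_add[of f 0 at_infinity g 0] by (auto intro: continuous_intros)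

lemma C_zero_cmult: "f \<in> C_zero \<Longrightarrow> (\<lambda>x. c * f x) \<in> C_zero"
  unfolding C_zero_def using tendsto_mult_left[of f 0 at_infinity c] by (auto intro: continuous_intros)

lemma C_zero_diff:
  assumes "f \<in> C_zero" "g \<in> C_zero" shows "(\<lambda>x. f x - g x) \<in> C_zero"
  using C_zero_add[OF assms(1) C_zero_cmult[OF assms(2), of "-1"]] by simp

lemma C_zero_sum:
  assumes "finite I" "\<And>i. i \<in> I \<Longrightarrow> F i \<in> C_zero"
  shows "(\<lambda>x. \<Sum>i\<in>I. F i x) \<in> C_zero"
  using assms
proof (induction I rule: finite_induct)
  case empty
  show ?case by (simp add: C_zero_def)
qed (auto intro!: C_zero_add)

lemma C_zero_pos_part: "f \<in> C_zero \<Longrightarrow> (\<lambda>x. max (f x) 0) \<in> C_zero"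
  unfolding C_zero_def using tendsto_max[of f 0 at_infinity "\<lambda>_. 0" 0] by (auto intro: continuous_intros)

text \<open>Time integrals of the semi-group will be placed in C_0 this way, as functions uniformly
  approximated by Riemann sums.\<close>

lemma C_zero_uniform_approx:
  assumes "\<And>e. e > 0 \<Longrightarrow> \<exists>g\<in>C_zero. \<forall>x. \<bar>f x - g x\<bar> \<le> e"
  shows "f \<in> C_zero"
proof (rule C_zeroI)
  have "\<exists>g. g \<in> C_zero \<and> (\<forall>x. \<bar>f x - g x\<bar> \<le> 1 / Suc n)" for n using assms[of "1 / Suc n"] by auto
  then obtain g where g: "\<And>n. g n \<in> C_zero" "\<And>n x. \<bar>f x - g n x\<bar> \<le> 1 / Suc n" by metis
  have "uniform_limit UNIV g f sequentially"
    unfolding uniform_limit_iff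
  proof (intro allI impI)
    fix e :: real assume "e > 0"
    then obtain N where N: "N > 0" "1 / real N < e" using real_arch_inverse[of e] by (auto simp: inverse_eq_divide)
    show "\<forall>\<^sub>F n in sequentially. \<forall>x\<in>UNIV. dist (g n x) (f x) < e"
    proof (rule eventually_sequentiallyI[of N], intro ballI)
      fix n x assume "n \<ge> N"
      then have "1 / real (Suc n) \<le> 1 / real N" using N(1) by (intro divide_left_mono) auto
      then show "dist (g n x) (f x) < e" using g(2)[of x n] N(2) by (simp add: dist_real_def)
    qed
  qed
  then show "continuous_on UNIV f"
    by (rule uniform_limit_theorem[rotated]) (simp_all add: C_zero_continuous g(1))
next
  fix e :: real assume "e > 0"
  then obtain g where g: "g \<in> C_zero" "\<And>x. \<bar>f x - g x\<bar> \<le> e / 2" using assms[of "e / 2"] by auto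
  obtain r where r: "\<And>x. norm x \<ge> r \<Longrightarrow> \<bar>g x\<bar> < e / 2" using C_zero_small[OF g(1), of "e / 2"] \<open>e > 0\<close> by auto
  have "\<bar>f x\<bar> \<le> e" if "norm x \<ge> r" for x using g(2)[of x] r[OF that] by linarith
  then show "\<exists>r. \<forall>x. norm x \<ge> r \<longrightarrow> \<bar>f x\<bar> \<le> e" by blast
qed

text \<open>A positive value is essential: it exceeds everything outside a large ball, so the
  maximum over the ball is global. A strictly negative function in C_0 has supremum 0, which is not
  attained.\<close>

lemma C_zero_attains_max:
  assumes f: "f \<in> C_zero" and "f y > 0"
  shows "\<exists>b. f b > 0 \<and> (\<forall>x. f x \<le> f b)"
proof -
  obtain r where r: "\<And>x. norm x \<ge> r \<Longrightarrow> \<bar>f x\<bar> < f y" using C_zero_small[OF f \<open>f y > 0\<close>] by auto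
  have y: "norm y \<le> r"
  proof (rule ccontr)
    assume "\<not> norm y \<le> r"
    then show False using r[of y] by simp
  qed
  have "\<exists>b\<in>cball 0 r. \<forall>x\<in>cball 0 r. f x \<le> f b"
    using C_zero_continuous[OF f] order_trans[OF norm_ge_zero y]
    by (intro continuous_attains_sup) (auto intro: continuous_on_subset)
  then obtain b where "\<forall>x\<in>cball 0 r. f x \<le> f b" by blast
  then have b: "f x \<le> f b" if "norm x \<le> r" for x using that by simp
  have yb: "f y \<le> f b" using b y by simp
  have "f x \<le> f b" for x
    using b[of x] r[of x] yb by (cases "norm x \<le> r") auto
  moreover have "f b > 0" using yb \<open>f y > 0\<close> by linarith
  ultimately show ?thesis by blast
qed

lemma abs_le_sup_norm:
  assumes "f \<in> C_zero" shows "\<bar>f x\<bar> \<le> sup_norm f"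
proof -
  obtain M where "\<forall>x. \<bar>f x\<bar> \<le> M" using C_zero_bounded[OF assms] by blast
  then show ?thesis
    unfolding sup_norm_def by (intro cSUP_upper bdd_aboveI2[of _ _ M]) auto
qed

lemma sup_norm_le: "(\<And>x. \<bar>f x\<bar> \<le> c) \<Longrightarrow> sup_norm f \<le> c"
  unfolding sup_norm_def by (intro cSUP_least) auto

section \<open>Riemann sums with an explicit error\<close>

lemma riemann_sum_piece:
  fixes q :: "real \<Rightarrow> real"
  assumes "continuous_on {c..c + d} q" "0 \<le> d" "\<And>x. x \<in> {c..c + d} \<Longrightarrow> \<bar>q x - q c\<bar> \<le> \<eta>"
  shows "\<bar>integral {c..c + d} q - d * q c\<bar> \<le> \<eta> * d"
proof -
  have "norm (integral {c..c + d} (\<lambda>x. q x - q c)) \<le> \<eta> * (c + d - c)"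
    using assms by (intro integral_bound) (auto intro: continuous_intros)
  moreover have "integral {c..c + d} (\<lambda>x. q x - q c) = integral {c..c + d} q - d * q c"
    using assms(1,2) by (subst integral_diff) (auto intro: integrable_continuous_interval)
  ultimately show ?thesis by simp
qed

lemma riemann_sum:
  fixes q :: "real \<Rightarrow> real"
  assumes "0 \<le> d"
    and "\<And>x y. \<lbrakk>c \<le> x; x \<le> y; y \<le> x + d\<rbrakk> \<Longrightarrow> \<bar>q y - q x\<bar> \<le> \<eta>"
    and "continuous_on {c..} q"
  shows "\<bar>integral {c..c + real N * d} q - d * (\<Sum>k<N. q (c + real k * d))\<bar> \<le> \<eta> * (real N * d)"
proof (induction N)
  case (Suc N)
  define m where "m = c + real N * d"
  have m: "c \<le> m" using assms(1) by (simp add: m_def)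
  have eq: "c + real (Suc N) * d = m + d" by (simp add: m_def algebra_simps)
  have "integral {c..m} q + integral {m..m + d} q = integral {c..m + d} q"
    using m assms(1,3) by (intro Henstock_Kurzweil_Integration.integral_combine integrable_continuous_interval)
      (auto intro: continuous_on_subset)
  moreover have "\<bar>integral {m..m + d} q - d * q m\<bar> \<le> \<eta> * d"
    using m assms by (intro riemann_sum_piece) (auto intro: continuous_on_subset)
  ultimately have "\<bar>integral {c..m + d} q - d * ((\<Sum>k<N. q (c + real k * d)) + q m)\<bar> \<le> \<eta> * (real N * d) + \<eta> * d"
    using Suc.IH[folded m_def] by (simp add: distrib_left)
  then show ?case unfolding eq by (simp add: m_def algebra_simps)
qed simp

locale feller =
  fixes T :: "real \<Rightarrow> (real ^ 'n \<Rightarrow> real) \<Rightarrow> (real ^ 'n \<Rightarrow> real)"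
  assumes feller: "feller_semigroup T"
begin

lemmas feller' = feller[unfolded feller_semigroup_def]
lemmas T_C_zero = feller'[THEN conjunct1, rule_format]
lemmas T_linear = feller'[THEN conjunct2, THEN conjunct1, rule_format]
lemmas T_nonneg = feller'[THEN conjunct2, THEN conjunct2, THEN conjunct1, rule_format]
lemmas T_contraction = feller'[THEN conjunct2, THEN conjunct2, THEN conjunct2, THEN conjunct1, rule_format]
lemmas T_0 = feller'[THEN conjunct2, THEN conjunct2, THEN conjunct2, THEN conjunct2, THEN conjunct1, rule_format]
lemmas T_semigroup = feller'[THEN conjunct2, THEN conjunct2, THEN conjunct2, THEN conjunct2, THEN conjunct2, THEN conjunct1, rule_format]
lemmas T_strongly_continuous = feller'[THEN conjunct2, THEN conjunct2, THEN conjunct2, THEN conjunct2, THEN conjunct2, THEN conjunct2, rule_format]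

section \<open>Order, continuity in time and time integrals for one semi-group\<close>

lemma T_add: "t \<ge> 0 \<Longrightarrow> f \<in> C_zero \<Longrightarrow> g \<in> C_zero \<Longrightarrow> T t (\<lambda>x. f x + g x) a = T t f a + T t g a"
  using T_linear[of t] by (simp add: linear_operator_on_def)

lemma T_cmult: "t \<ge> 0 \<Longrightarrow> f \<in> C_zero \<Longrightarrow> T t (\<lambda>x. c * f x) a = c * T t f a"
  using T_linear[of t] by (simp add: linear_operator_on_def)

lemma T_diff:
  assumes "t \<ge> 0" and f: "f \<in> C_zero" and g: "g \<in> C_zero"
  shows "T t (\<lambda>x. f x - g x) a = T t f a - T t g a"
  using T_add[OF assms(1) f C_zero_cmult[OF g], of "-1"] T_cmult[OF assms(1) g, of "-1"] by simp

lemma T_sum: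
  assumes "t \<ge> 0" "finite I" "\<And>i. i \<in> I \<Longrightarrow> F i \<in> C_zero"
  shows "T t (\<lambda>x. \<Sum>i\<in>I. F i x) a = (\<Sum>i\<in>I. T t (F i) a)"
  using assms(2,3)
proof (induction I rule: finite_induct)
  case empty
  have "(\<lambda>_. 0) \<in> C_zero" by (simp add: C_zero_def)
  from T_cmult[OF assms(1) this, of 0] show ?case by simp
next
  case (insert i I)
  then show ?case
    using T_add[OF assms(1), of "F i" "\<lambda>x. \<Sum>i\<in>I. F i x" a] by (simp add: C_zero_sum)
qed

lemma T_abs_le:
  assumes "t \<ge> 0" "f \<in> C_zero" "\<And>x. \<bar>f x\<bar> \<le> c"
  shows "\<bar>T t f a\<bar> \<le> c"
proof -
  have "\<bar>T t f a\<bar> \<le> sup_norm (T t f)" by (intro abs_le_sup_norm T_C_zero assms)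
  also have "\<dots> \<le> sup_norm f" by (intro T_contraction assms)
  also have "\<dots> \<le> c" by (intro sup_norm_le assms)
  finally show ?thesis .
qed

text \<open>A nonzero constant is not in C_0, so positivity cannot be applied to c - f. The positive
  part of f is in C_0, dominates f and has norm at most c, so positivity and contraction
  combine.\<close>

lemma T_le:
  assumes t: "t \<ge> 0" and f: "f \<in> C_zero" and "\<And>x. f x \<le> c" "c \<ge> 0"
  shows "T t f a \<le> c"
proof -
  have "0 \<le> T t (\<lambda>x. max (f x) 0 - f x) a"
    by (intro T_nonneg C_zero_diff C_zero_pos_part t f) auto
  then have "T t f a \<le> T t (\<lambda>x. max (f x) 0) a"
    using T_diff[OF t C_zero_pos_part[OF f] f] by simp
  also have "\<dots> \<le> c"
    using T_abs_le[OF t C_zero_pos_part[OF f], of c a] assms(3,4) by (simp add: abs_le_iff)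
  finally show ?thesis .
qed

lemma T_near_0:
  assumes f: "f \<in> C_zero" and "e > 0"
  shows "\<exists>d>0. \<forall>t. 0 \<le> t \<and> t \<le> d \<longrightarrow> (\<forall>a. \<bar>T t f a - f a\<bar> \<le> e)"
proof -
  have "\<forall>\<^sub>F t in at_right 0. dist (sup_norm (\<lambda>a. T t f a - f a)) 0 < e"
    using tendstoD[OF T_strongly_continuous[OF f] \<open>e > 0\<close>] .
  then obtain d where d: "d > 0" "\<And>t. 0 < t \<Longrightarrow> t < d \<Longrightarrow> \<bar>sup_norm (\<lambda>a. T t f a - f a)\<bar> < e"
    unfolding eventually_at_right_field by auto
  have "\<bar>T t f a - f a\<bar> \<le> e" if "0 \<le> t" "t \<le> d / 2" for t a
  proof (cases "t = 0")
    case True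
    then show ?thesis using T_0[OF f] \<open>e > 0\<close> by simp
  next
    case False
    then have "\<bar>sup_norm (\<lambda>a. T t f a - f a)\<bar> < e" using that d(1) by (intro d(2)) auto
    moreover have "\<bar>T t f a - f a\<bar> \<le> sup_norm (\<lambda>a. T t f a - f a)"
      by (rule abs_le_sup_norm[OF C_zero_diff[OF T_C_zero[OF that(1) f] f]])
    ultimately show ?thesis by linarith
  qed
  then show ?thesis using d(1) by (intro exI[of _ "d / 2"]) auto
qed

text \<open>T_t f - T_s f = T_s (T_(t-s) f - f), so by contraction the modulus at time 0 serves
  every starting time and every point.\<close>

lemma T_uniformly_continuous:
  assumes f: "f \<in> C_zero" and "e > 0"
  shows "\<exists>d>0. \<forall>s t a. 0 \<le> s \<and> s \<le> t \<and> t \<le> s + d \<longrightarrow> \<bar>T t f a - T s f a\<bar> \<le> e"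
proof -
  obtain d where d: "d > 0" "\<And>t a. 0 \<le> t \<Longrightarrow> t \<le> d \<Longrightarrow> \<bar>T t f a - f a\<bar> \<le> e"
    using T_near_0[OF assms] by blast
  have "\<bar>T t f a - T s f a\<bar> \<le> e" if "0 \<le> s" "s \<le> t" "t \<le> s + d" for s t a
  proof -
    have m: "T (t - s) f \<in> C_zero" using that by (intro T_C_zero f) auto
    have "T t f a - T s f a = T s (\<lambda>x. T (t - s) f x - f x) a"
      using T_semigroup[of s "t - s" f] that f T_diff[OF that(1) m f] by simp
    also have "\<bar>\<dots>\<bar> \<le> e"
      using that by (intro T_abs_le C_zero_diff m f d) auto
    finally show ?thesis .
  qed
  then show ?thesis using d(1) by blast
qed

lemma T_continuous_on:
  assumes f: "f \<in> C_zero" shows "continuous_on {0..} (\<lambda>t. T t f a)"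
proof (rule continuous_onI)
  fix s e :: real assume s: "s \<in> {0..}" and "e > 0"
  obtain d where d: "d > 0" "\<And>s t a. 0 \<le> s \<Longrightarrow> s \<le> t \<Longrightarrow> t \<le> s + d \<Longrightarrow> \<bar>T t f a - T s f a\<bar> \<le> e"
    using T_uniformly_continuous[OF f \<open>e > 0\<close>] by blast
  have "dist (T t f a) (T s f a) \<le> e" if "t \<in> {0..}" "dist t s < d" for t
    using d(2)[of s t a] d(2)[of t s a] that s by (cases "s \<le> t") (auto simp: dist_real_def abs_minus_commute)
  then show "\<exists>d>0. \<forall>t\<in>{0..}. dist t s < d \<longrightarrow> dist (T t f a) (T s f a) \<le> e" using d(1) by blast
qed

lemma T_continuous_on_interval:
  assumes "f \<in> C_zero" "0 \<le> s" shows "continuous_on {s..t} (\<lambda>t. T t f a)"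
  by (rule continuous_on_subset[OF T_continuous_on[OF assms(1)]]) (use assms(2) in auto)

lemma T_integrable:
  assumes "f \<in> C_zero" "0 \<le> s" shows "(\<lambda>t. T t f a) integrable_on {s..t}"
  by (intro integrable_continuous_interval T_continuous_on_interval assms)

lemma integral_T_combine:
  assumes "f \<in> C_zero" "0 \<le> r" "r \<le> s" "s \<le> t"
  shows "integral {r..s} (\<lambda>x. T x f a) + integral {s..t} (\<lambda>x. T x f a) = integral {r..t} (\<lambda>x. T x f a)"
  using assms by (intro Henstock_Kurzweil_Integration.integral_combine T_integrable) auto

text \<open>The same mesh works for all \<open>h\<close> and \<open>a\<close>. Hence one Riemann sum
  approximates the integral over [0, t] while its image under \<open>T h\<close> approximates the
  shifted integral.\<close>

lemma T_integral_riemann: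
  assumes u: "u \<in> C_zero" and t: "t \<ge> 0" and "e > 0"
  shows "\<exists>N d. 0 \<le> d \<and> (\<forall>h\<ge>0. \<forall>a.
    \<bar>integral {h..h + t} (\<lambda>s. T s u a) - d * (\<Sum>k<N. T (h + real k * d) u a)\<bar> \<le> e)"
proof -
  define \<eta> where "\<eta> = e / (t + 1)"
  have "\<eta> > 0" using t \<open>e > 0\<close> by (simp add: \<eta>_def)
  then obtain \<delta> where \<delta>: "\<delta> > 0"
      "\<forall>s t a. 0 \<le> s \<and> s \<le> t \<and> t \<le> s + \<delta> \<longrightarrow> \<bar>T t u a - T s u a\<bar> \<le> \<eta>"
    using T_uniformly_continuous[OF u] by blast
  obtain N :: nat where N: "t < real N * \<delta>" using ex_less_of_nat_mult[OF \<delta>(1)] by blast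
  have "N > 0" using N t by (cases N) auto
  define d where "d = t / N"
  have d: "0 \<le> d" "d \<le> \<delta>" "real N * d = t" using t N \<open>N > 0\<close> by (auto simp: d_def field_simps)
  have "\<bar>integral {h..h + t} (\<lambda>s. T s u a) - d * (\<Sum>k<N. T (h + real k * d) u a)\<bar> \<le> e" if "h \<ge> 0" for h a
  proof -
    have "\<bar>integral {h..h + t} (\<lambda>s. T s u a) - d * (\<Sum>k<N. T (h + real k * d) u a)\<bar> \<le> \<eta> * t"
      unfolding d(3)[symmetric]
    proof (rule riemann_sum[OF d(1)])
      show "continuous_on {h..} (\<lambda>s. T s u a)"
        by (rule continuous_on_subset[OF T_continuous_on[OF u]]) (use that in auto)
      show "\<bar>T y u a - T x u a\<bar> \<le> \<eta>" if "h \<le> x" "x \<le> y" "y \<le> x + d" for x y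
        using that \<open>h \<ge> 0\<close> d(2) by (intro \<delta>(2)[rule_format]) auto
    qed
    also have "\<dots> \<le> e" using t \<open>e > 0\<close> by (simp add: \<eta>_def field_simps)
    finally show ?thesis .
  qed
  then show ?thesis using d(1) by blast
qed

text \<open>\<open>T h\<close> passes through finite sums by linearity and through uniform
  approximation by contraction, so pointwise real integrals suffice and no C_0-valued integral is
  formed.\<close>

lemma
  assumes u: "u \<in> C_zero" and t: "t \<ge> 0"
  defines "J \<equiv> \<lambda>a. integral {0..t} (\<lambda>s. T s u a)"
  shows integral_T_C_zero: "J \<in> C_zero"
    and T_integral_T: "h \<ge> 0 \<Longrightarrow> T h J a = integral {h..h + t} (\<lambda>s. T s u a)"
proof -
  have approx: "\<exists>R\<in>C_zero. (\<forall>a. \<bar>J a - R a\<bar> \<le> e) \<and>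
      (\<forall>h\<ge>0. \<forall>a. \<bar>integral {h..h + t} (\<lambda>s. T s u a) - T h R a\<bar> \<le> e)" if e: "e > 0" for e
  proof -
    obtain N d where Nd: "0 \<le> d" "\<And>h a. h \<ge> 0 \<Longrightarrow>
      \<bar>integral {h..h + t} (\<lambda>s. T s u a) - d * (\<Sum>k<N. T (h + real k * d) u a)\<bar> \<le> e"
      using T_integral_riemann[OF u t e] by blast
    define R where "R a = d * (\<Sum>k<N. T (real k * d) u a)" for a
    have m: "T (real k * d) u \<in> C_zero" for k using Nd(1) by (intro T_C_zero u) auto
    have ms: "(\<lambda>a. \<Sum>k<N. T (real k * d) u a) \<in> C_zero" by (intro C_zero_sum m) auto
    have "R \<in> C_zero" unfolding R_def[abs_def] by (rule C_zero_cmult[OF ms])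
    moreover have "T h R a = d * (\<Sum>k<N. T (h + real k * d) u a)" if "h \<ge> 0" for h a
      unfolding R_def[abs_def] using T_cmult[OF that ms] T_sum[OF that _ m, of "{..<N}"] Nd(1) that
      by (simp add: T_semigroup u)
    ultimately show ?thesis
      using Nd(2) Nd(2)[of 0] by (intro bexI[of _ R]) (auto simp: R_def J_def)
  qed
  show J: "J \<in> C_zero" by (rule C_zero_uniform_approx) (use approx in blast)
  show "T h J a = integral {h..h + t} (\<lambda>s. T s u a)" if h: "h \<ge> 0"
  proof -
    have "\<bar>T h J a - integral {h..h + t} (\<lambda>s. T s u a)\<bar> \<le> e" if "e > 0" for e
    proof -
      obtain R where R: "R \<in> C_zero" "\<And>a. \<bar>J a - R a\<bar> \<le> e / 2"
          "\<bar>integral {h..h + t} (\<lambda>s. T s u a) - T h R a\<bar> \<le> e / 2"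
        using approx[of "e / 2"] \<open>e > 0\<close> h by auto
      have "\<bar>T h J a - T h R a\<bar> \<le> e / 2"
        using T_abs_le[OF h C_zero_diff[OF J R(1)] R(2), of a] T_diff[OF h J R(1)] by simp
      then show ?thesis using R(3) by linarith
    qed
    then have "\<bar>T h J a - integral {h..h + t} (\<lambda>s. T s u a)\<bar> \<le> 0" by (rule field_le_epsilon[of _ 0, simplified])
    then show ?thesis by simp
  qed
qed

text \<open>The overlap of [h, h + t] with [0, t] cancels. For small \<open>h\<close> only the two
  end pieces remain, whose averages converge; this puts time integrals in the domain of the
  generator.\<close>

lemma T_integral_T_diff:
  assumes "u \<in> C_zero" "t \<ge> 0" "h \<ge> 0"
  shows "T h (\<lambda>a. integral {0..t} (\<lambda>s. T s u a)) a - integral {0..t} (\<lambda>s. T s u a)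
    = integral {t..t + h} (\<lambda>s. T s u a) - integral {0..h} (\<lambda>s. T s u a)"
  using integral_T_combine[of u 0 h "h + t" a] integral_T_combine[of u 0 t "t + h" a] assms
  by (simp add: T_integral_T add.commute)

lemma integral_T_average_tendsto:
  assumes u: "u \<in> C_zero" and t: "t \<ge> 0"
  shows "((\<lambda>h. (1 / h) * integral {t..t + h} (\<lambda>s. T s u a)) \<longlongrightarrow> T t u a) (at_right 0)"
  unfolding tendsto_iff
proof (intro allI impI)
  fix e :: real assume "e > 0"
  then have "e / 2 > 0" by simp
  then obtain d where d: "d > 0"
      "\<forall>s t a. 0 \<le> s \<and> s \<le> t \<and> t \<le> s + d \<longrightarrow> \<bar>T t u a - T s u a\<bar> \<le> e / 2"
    using T_uniformly_continuous[OF u] by blast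
  have "dist ((1 / h) * integral {t..t + h} (\<lambda>s. T s u a)) (T t u a) < e" if h: "0 < h" "h < d" for h
  proof -
    have "\<bar>integral {t..t + h} (\<lambda>s. T s u a) - h * T t u a\<bar> \<le> e / 2 * h"
      using t h d(2) by (intro riemann_sum_piece T_continuous_on_interval u) auto
    then have "\<bar>integral {t..t + h} (\<lambda>s. T s u a) - h * T t u a\<bar> / h \<le> e / 2"
      using h by (simp add: field_simps)
    moreover have "\<bar>integral {t..t + h} (\<lambda>s. T s u a) - h * T t u a\<bar> / h
        = \<bar>(1 / h) * integral {t..t + h} (\<lambda>s. T s u a) - T t u a\<bar>"
      using h by (simp add: abs_divide[symmetric, of _ h, unfolded abs_of_pos[OF h(1)]] diff_divide_distrib)
    ultimately show ?thesis using \<open>e > 0\<close> by (simp add: dist_real_def)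
  qed
  then show "\<forall>\<^sub>F h in at_right 0. dist ((1 / h) * integral {t..t + h} (\<lambda>s. T s u a)) (T t u a) < e"
    unfolding eventually_at_right_field using d(1) by blast
qed

end

text \<open>Discounting is killing at rate 1: the generator A becomes A - 1, which gives the maximum
  principle a strict margin and makes the resolvent integral converge.\<close>

lemma feller_discounted:
  assumes "feller_semigroup T"
  shows "feller_semigroup (\<lambda>t f a. exp (- t) * T t f a)"
proof -
  interpret feller T by standard fact
  have le: "\<bar>exp (- t) * T t f a\<bar> \<le> sup_norm f" if "t \<ge> 0" "f \<in> C_zero" for t f a
  proof -
    have "exp (- t) * \<bar>T t f a\<bar> \<le> 1 * \<bar>T t f a\<bar>" using that by (intro mult_right_mono) auto
    also have "\<dots> \<le> sup_norm f" using that by (auto intro: T_abs_le abs_le_sup_norm)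
    finally show ?thesis by (simp add: abs_mult)
  qed
  have cont: "((\<lambda>t. sup_norm (\<lambda>a. exp (- t) * T t f a - f a)) \<longlongrightarrow> 0) (at_right 0)" if f: "f \<in> C_zero" for f
  proof (rule tendsto_sandwich)
    have b: "\<bar>exp (- t) * T t f a - f a\<bar> \<le> sup_norm (\<lambda>a. T t f a - f a) + (1 - exp (- t)) * sup_norm f"
      if t: "t > 0" for t a
    proof -
      have "exp (- t) * T t f a - f a = (T t f a - f a) + - ((1 - exp (- t)) * T t f a)"
        by (simp add: algebra_simps)
      also have "\<bar>\<dots>\<bar> \<le> \<bar>T t f a - f a\<bar> + \<bar>(1 - exp (- t)) * T t f a\<bar>"
        using abs_triangle_ineq[of "T t f a - f a" "- ((1 - exp (- t)) * T t f a)"] by simp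
      also have "\<dots> \<le> sup_norm (\<lambda>a. T t f a - f a) + (1 - exp (- t)) * sup_norm f"
      proof (intro add_mono)
        have "(\<lambda>a. T t f a - f a) \<in> C_zero" using t by (intro C_zero_diff T_C_zero f) auto
        then show "\<bar>T t f a - f a\<bar> \<le> sup_norm (\<lambda>a. T t f a - f a)" by (rule abs_le_sup_norm)
        show "\<bar>(1 - exp (- t)) * T t f a\<bar> \<le> (1 - exp (- t)) * sup_norm f"
          using t f by (auto simp: abs_mult intro!: mult_left_mono T_abs_le abs_le_sup_norm)
      qed
      finally show ?thesis .
    qed
    show "\<forall>\<^sub>F t in at_right 0. sup_norm (\<lambda>a. exp (- t) * T t f a - f a)
        \<le> sup_norm (\<lambda>a. T t f a - f a) + (1 - exp (- t)) * sup_norm f"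
      unfolding eventually_at_filter by (intro always_eventually) (auto intro!: sup_norm_le b)
    have "0 \<le> sup_norm (\<lambda>a. exp (- t) * T t f a - f a)" if t: "t > 0" for t
    proof -
      have "(\<lambda>a. exp (- t) * T t f a - f a) \<in> C_zero"
        using t by (intro C_zero_diff C_zero_cmult T_C_zero f) auto
      from abs_le_sup_norm[OF this] show ?thesis using abs_ge_zero order_trans by blast
    qed
    then show "\<forall>\<^sub>F t in at_right 0. 0 \<le> sup_norm (\<lambda>a. exp (- t) * T t f a - f a)"
      unfolding eventually_at_filter by (intro always_eventually) auto
    have "((\<lambda>t :: real. (1 - exp (- t)) * sup_norm f) \<longlongrightarrow> (1 - exp (- 0)) * sup_norm f) (at_right 0)"
      by (intro tendsto_intros)
    then show "((\<lambda>t. sup_norm (\<lambda>a. T t f a - f a) + (1 - exp (- t)) * sup_norm f) \<longlongrightarrow> 0) (at_right 0)"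
      using tendsto_add[OF T_strongly_continuous[OF f]] by force
  qed simp
  show ?thesis
    unfolding feller_semigroup_def
  proof (intro conjI allI impI ballI)
    show "linear_operator_on C_zero (\<lambda>f a. exp (- t) * T t f a)" if "t \<ge> 0" for t
      using that unfolding linear_operator_on_def by (auto simp: T_add T_cmult algebra_simps)
    show "(\<lambda>a. exp (- (s + t)) * T (s + t) f a) = (\<lambda>a. exp (- s) * T s (\<lambda>a. exp (- t) * T t f a) a)"
      if "s \<ge> 0" "t \<ge> 0" "f \<in> C_zero" for s t f
      using exp_add[of "- s" "- t"] by (simp add: mult.assoc T_semigroup[OF that] T_cmult[OF that(1) T_C_zero[OF that(2,3)]])
    show "0 \<le> exp (- t) * T t f a" if "t \<ge> 0" "f \<in> C_zero" "\<forall>a. 0 \<le> f a" for t f a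
      using that by (intro mult_nonneg_nonneg T_nonneg) auto
  qed (auto intro: C_zero_cmult T_C_zero sup_norm_le le cont simp: T_0)
qed

text \<open>The pointwise generator is dissipative, because it satisfies the positive maximum principle.\<close>

lemma feller_dissipative:
  assumes T: "feller_semigroup T" and p: "p \<in> C_zero"
    and lim: "\<And>b. ((\<lambda>t. (1 / t) * (exp (- t) * T t p b - p b)) \<longlongrightarrow> r b) (at_right 0)"
    and r: "\<And>b. - c \<le> r b" and "c \<ge> 0"
  shows "p b \<le> c"
proof (rule ccontr)
  interpret feller T by standard fact
  assume "\<not> p b \<le> c"
  then have "p b > c" by simp
  then obtain m where m: "p m > 0" "\<And>x. p x \<le> p m" using C_zero_attains_max[OF p, of b] \<open>c \<ge> 0\<close> by force
  \<comment> \<open>At the positive maximum \<open>m\<close>, \<open>T t p m\<close> cannot exceed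
    \<open>p m\<close>, so the discount alone bounds the quotient and its limit is at most -p(m).
    With the lower bound -c on \<open>r\<close> this gives p(m) \<le> c; c \<ge> 0 ensured that a
    positive maximum exists.\<close>
  have "(1 / t) * (exp (- t) * T t p m - p m) \<le> ((exp (- t) - 1) / t) * p m" if "t > 0" for t
  proof -
    have "exp (- t) * T t p m \<le> exp (- t) * p m"
      using m that by (intro mult_left_mono T_le p) auto
    then show ?thesis using that by (simp add: field_simps)
  qed
  then have "\<forall>\<^sub>F t in at_right 0. (1 / t) * (exp (- t) * T t p m - p m) \<le> ((exp (- t) - 1) / t) * p m"
    unfolding eventually_at_filter by (intro always_eventually) auto
  moreover have "((\<lambda>t :: real. exp (- t)) has_real_derivative - 1) (at 0 within {0<..})"
    by (auto intro!: derivative_eq_intros)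
  then have "((\<lambda>t :: real. (exp (- t) - 1) / t) \<longlongrightarrow> - 1) (at_right 0)"
    by (simp add: has_field_derivative_iff)
  then have "((\<lambda>t. ((exp (- t) - 1) / t) * p m) \<longlongrightarrow> - 1 * p m) (at_right 0)"
    by (intro tendsto_mult tendsto_const)
  ultimately have "r m \<le> - 1 * p m"
    by (intro tendsto_le[OF _ _ lim[of m]]) auto
  then show False using r[of m] m(2)[of b] \<open>p b > c\<close> by linarith
qed

text \<open>The limit in the generator is only pointwise, so \<open>t \<mapsto> T t f b\<close> cannot be differentiated directly.
  Dissipativity identifies \<open>f\<close> with the resolvent \<open>\<integral>\<^sub>0\<^sup>\<infinity> exp (- s) * T s (f - g) ds\<close>.\<close>

lemma feller_generator_integral:
  assumes T: "feller_semigroup T" and gen: "(f, g) \<in> feller_generator T" and h: "h \<ge> 0"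
  shows "exp (- h) * T h f b - f b = - integral {0..h} (\<lambda>s. exp (- s) * T s (\<lambda>x. f x - g x) b)"
proof -
  define S where "S = (\<lambda>t f a. exp (- t) * T t f a)"
  interpret S: feller S by standard (simp add: S_def feller_discounted[OF T])
  interpret feller T by standard fact
  have f: "f \<in> C_zero" and g: "g \<in> C_zero"
    and lim: "\<And>a. ((\<lambda>t. (1 / t) * (T t f a - f a)) \<longlongrightarrow> g a) (at_right 0)"
    using gen by (auto simp: feller_generator_def)
  define u where "u x = f x - g x" for x
  have u: "u \<in> C_zero" unfolding u_def[abs_def] by (rule C_zero_diff[OF f g])
  obtain C where C: "C \<ge> 0" "\<And>x. \<bar>u x\<bar> \<le> C" using C_zero_bounded[OF u] by blast
  have Su: "\<bar>S t u a\<bar> \<le> C * exp (- t)" if "t \<ge> 0" for t a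
    using T_abs_le[OF that u C(2), of a] by (simp add: S_def abs_mult mult.commute)
  define J where "J t a = integral {0..t} (\<lambda>s. S s u a)" for t a
  have J: "J t \<in> C_zero" if "t \<ge> 0" for t
    unfolding J_def[abs_def] by (rule S.integral_T_C_zero[OF u that])
  have Jdiff: "S h (J t) a - J t a = integral {t..t + h} (\<lambda>s. S s u a) - integral {0..h} (\<lambda>s. S s u a)"
    if "t \<ge> 0" "h \<ge> 0" for t h a
    unfolding J_def[abs_def] by (rule S.T_integral_T_diff[OF u that])
  \<comment> \<open>The pointwise generator of the discounted semi-group sends f to g - f, that is
    to -u.\<close>
  have Slim: "((\<lambda>t. (1 / t) * (S t f a - f a)) \<longlongrightarrow> - u a) (at_right 0)" for a
  proof -
    have "((\<lambda>t :: real. exp (- t)) has_real_derivative - 1) (at 0 within {0<..})"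
      by (auto intro!: derivative_eq_intros)
    then have "((\<lambda>t :: real. (exp (- t) - 1) / t) \<longlongrightarrow> - 1) (at_right 0)"
      by (simp add: has_field_derivative_iff)
    moreover have "((\<lambda>t :: real. exp (- t)) \<longlongrightarrow> exp (- 0)) (at_right 0)" by (intro tendsto_intros)
    ultimately have "((\<lambda>t. exp (- t) * ((1 / t) * (T t f a - f a)) + (exp (- t) - 1) / t * f a)
        \<longlongrightarrow> exp (- 0) * g a + - 1 * f a) (at_right 0)"
      by (intro tendsto_add tendsto_mult lim tendsto_const)
    moreover have "exp (- t) * ((1 / t) * (T t f a - f a)) + (exp (- t) - 1) / t * f a = (1 / t) * (S t f a - f a)" for t
      by (simp add: S_def diff_divide_distrib algebra_simps)
    ultimately show ?thesis by (simp add: u_def)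
  qed
  \<comment> \<open>The truncated resolvent integral is sent to S_t u - u, so it misses solving the
    equation of f only by S_t u, of size C exp(-t).\<close>
  have Jlim: "((\<lambda>h. (1 / h) * (S h (J t) a - J t a)) \<longlongrightarrow> S t u a - u a) (at_right 0)" if "t \<ge> 0" for t a
  proof -
    have "((\<lambda>h. (1 / h) * integral {t..t + h} (\<lambda>s. S s u a) - (1 / h) * integral {0..0 + h} (\<lambda>s. S s u a))
        \<longlongrightarrow> S t u a - S 0 u a) (at_right 0)"
      using that by (intro tendsto_diff S.integral_T_average_tendsto u) auto
    then have "((\<lambda>h. (1 / h) * integral {t..t + h} (\<lambda>s. S s u a) - (1 / h) * integral {0..0 + h} (\<lambda>s. S s u a))
        \<longlongrightarrow> S t u a - u a) (at_right 0)"
      by (simp add: S.T_0[OF u])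
    then show ?thesis
      by (rule Lim_transform_eventually)
        (use Jdiff[OF that] in \<open>auto simp: eventually_at_filter simp flip: diff_divide_distrib intro!: always_eventually\<close>)
  qed
  \<comment> \<open>f - J_t has generator value -S_t u. Dissipativity is one-sided, so it is applied
    to both this difference and its negative.\<close>
  have fJ: "\<bar>f a - J t a\<bar> \<le> C * exp (- t)" if t: "t \<ge> 0" for t a
  proof -
    have L1: "((\<lambda>h. (1 / h) * (S h (\<lambda>x. f x - J t x) a - (f a - J t a))) \<longlongrightarrow> - u a - (S t u a - u a)) (at_right 0)" for a
      using tendsto_diff[OF Slim[of a] Jlim[OF t, of a]]
      by (rule Lim_transform_eventually)
        (auto simp: eventually_at_filter S.T_diff[OF _ f J[OF t]] diff_divide_distrib[symmetric] intro!: always_eventually)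
    have L2: "((\<lambda>h. (1 / h) * (S h (\<lambda>x. J t x - f x) a - (J t a - f a))) \<longlongrightarrow> (S t u a - u a) - - u a) (at_right 0)" for a
      using tendsto_diff[OF Jlim[OF t, of a] Slim[of a]]
      by (rule Lim_transform_eventually)
        (auto simp: eventually_at_filter S.T_diff[OF _ J[OF t] f] diff_divide_distrib[symmetric] intro!: always_eventually)
    have r: "- (C * exp (- t)) \<le> - u a - (S t u a - u a)" "- (C * exp (- t)) \<le> (S t u a - u a) - - u a" for a
      using Su[OF t, of a] by linarith+
    have "f a - J t a \<le> C * exp (- t)"
      by (rule feller_dissipative[OF T C_zero_diff[OF f J[OF t]] L1[unfolded S_def] r(1)[unfolded S_def]])
        (use C(1) in simp)
    moreover have "J t a - f a \<le> C * exp (- t)"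
      by (rule feller_dissipative[OF T C_zero_diff[OF J[OF t] f] L2[unfolded S_def] r(2)[unfolded S_def]])
        (use C(1) in simp)
    ultimately show ?thesis by (simp add: abs_le_iff)
  qed
  \<comment> \<open>Replacing f by J_t costs C exp(-t) in each of two places, and for J_t the
    identity \<open>Jdiff\<close> leaves only the integral over [t, t + h], at most h C exp(-t). The
    left side is free of t, so letting t tend to infinity shows that it is 0.\<close>
  have bound: "\<bar>S h f b - f b + integral {0..h} (\<lambda>s. S s u b)\<bar> \<le> (2 + h) * C * exp (- t)" if t: "t \<ge> 0" for t
  proof -
    have 1: "\<bar>S h f b - S h (J t) b\<bar> \<le> C * exp (- t)"
      using S.T_abs_le[OF h C_zero_diff[OF f J[OF t]] fJ[OF t], of b] S.T_diff[OF h f J[OF t]] by simp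
    have "norm (integral {t..t + h} (\<lambda>s. S s u b)) \<le> C * exp (- t) * (t + h - t)"
    proof (rule integral_bound)
      show "continuous_on {t..t + h} (\<lambda>s. S s u b)"
        by (rule S.T_continuous_on_interval[OF u t])
      show "norm (S s u b) \<le> C * exp (- t)" if "s \<in> {t..t + h}" for s
        using that t C(1) by (auto intro!: order_trans[OF Su] mult_left_mono)
    qed (use h in auto)
    then have 2: "\<bar>integral {t..t + h} (\<lambda>s. S s u b)\<bar> \<le> h * (C * exp (- t))" by (simp add: mult.commute)
    have "(2 + h) * C * exp (- t) = 2 * (C * exp (- t)) + h * (C * exp (- t))" by (simp add: algebra_simps)
    then show ?thesis using 1 2 fJ[OF t, of b] Jdiff[OF t h, of b] by linarith
  qed
  have "((\<lambda>t. (2 + h) * C * exp (- t)) \<longlongrightarrow> (2 + h) * C * 0) at_top"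
    by (intro tendsto_mult tendsto_const filterlim_compose[OF exp_at_bot] filterlim_uminus_at_bot_at_top)
  moreover have "\<forall>\<^sub>F t in at_top. \<bar>S h f b - f b + integral {0..h} (\<lambda>s. S s u b)\<bar> \<le> (2 + h) * C * exp (- t)"
    using eventually_ge_at_top[of 0] by eventually_elim (rule bound)
  ultimately have "\<bar>S h f b - f b + integral {0..h} (\<lambda>s. S s u b)\<bar> \<le> (2 + h) * C * 0"
    by (intro tendsto_lowerbound[where F = at_top]) auto
  then show ?thesis by (simp add: S_def u_def[abs_def])
qed

text \<open>Undoing the discount, T_t f(b) = exp(t) (f(b) - G(t)) with G the integral of a
  continuous function. This is differentiable on the whole interval with derivative T_t f(b) - T_t
  u(b) = T_t g(b), and the classical mean value theorem applies at the fixed point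
  \<open>b\<close>.\<close>

lemma feller_generator_mvt:
  assumes T: "feller_semigroup T" and gen: "(f, g) \<in> feller_generator T" and h: "h > 0"
  shows "\<exists>s\<in>{0<..<h}. T h f b - f b = h * T s g b"
proof -
  interpret feller T by standard fact
  have f: "f \<in> C_zero" and g: "g \<in> C_zero" using gen by (auto simp: feller_generator_def)
  define u where "u x = f x - g x" for x
  have u: "u \<in> C_zero" unfolding u_def[abs_def] by (rule C_zero_diff[OF f g])
  define q where "q s = exp (- s) * T s u b" for s
  define G where "G t = integral {0..t} q" for t
  have q: "continuous_on {0..h} q"
    unfolding q_def by (intro continuous_intros T_continuous_on_interval[OF u]) simp
  have Tf: "exp t * (f b - G t) = T t f b" if "t \<ge> 0" for t
  proof -
    have "f b - G t = exp (- t) * T t f b"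
      using feller_generator_integral[OF T gen that, of b] unfolding G_def q_def u_def[abs_def] by linarith
    then show ?thesis by (simp add: exp_minus)
  qed
  have "((\<lambda>t. T t f b) has_real_derivative T t g b) (at t within {0..h})" if t: "t \<in> {0..h}" for t
  proof -
    have "(G has_real_derivative q t) (at t within {0..h})"
      unfolding G_def by (rule integral_has_real_derivative[OF q t])
    then have "((\<lambda>t. exp t * (f b - G t)) has_real_derivative exp t * (f b - G t) - exp t * q t) (at t within {0..h})"
      by (auto intro!: derivative_eq_intros)
    moreover have "exp t * (f b - G t) - exp t * q t = T t g b"
    proof -
      have "T t u b = T t f b - T t g b" unfolding u_def[abs_def] using t by (intro T_diff f g) auto
      moreover have "exp t * q t = T t u b"
        unfolding q_def by (simp add: mult.assoc[symmetric] exp_add[symmetric])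
      ultimately show ?thesis using Tf[of t] t by simp
    qed
    ultimately have "((\<lambda>t. exp t * (f b - G t)) has_real_derivative T t g b) (at t within {0..h})" by simp
    then show ?thesis
      by (rule has_field_derivative_transform_within[of _ _ _ _ 1]) (use t Tf in auto)
  qed
  then have "\<exists>s\<in>{0<..<h}. T h f b - T 0 f b = (*) (T s g b) (h - 0)"
    using h by (intro mvt_simple) (auto simp: has_field_derivative_def)
  then show ?thesis by (simp add: T_0[OF f] mult.commute)
qed

section \<open>Convergence\<close>

text \<open>By positivity the mass that \<open>T s\<close> moves out of the support of \<open>\<phi>\<close> is at most \<open>1 - T s \<phi> a\<close>;
  this controls the displacement without representing \<open>T s\<close> by a kernel.\<close>

lemma (in feller) T_localized:
  assumes g: "g \<in> C_zero" "\<And>x. \<bar>g x\<bar> \<le> M" and \<phi>: "\<phi> \<in> C_zero" "\<And>x. 0 \<le> \<phi> x" "\<And>x. \<phi> x \<le> 1"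
    and near: "\<And>x. \<phi> x \<noteq> 0 \<Longrightarrow> \<bar>g x - g a\<bar> \<le> \<eta>" and "\<eta> \<ge> 0" and s: "s \<ge> 0"
  shows "\<bar>T s g a - g a\<bar> \<le> \<eta> + 2 * M * (1 - T s \<phi> a)"
proof -
  have "M \<ge> 0" using g(2)[of a] by linarith
  have p: "T s \<phi> a \<le> 1" using \<phi>(3) by (intro T_le s \<phi>(1)) auto
  \<comment> \<open>g(a) \<phi> stands in for the constant g(a), which is not in C_0. Where \<phi>
    is nonzero, g is within \<eta> of g(a) and the cut-off costs M (1 - \<phi>); where \<phi> = 0,
    the trivial bound M on g suffices.\<close>
  have pt: "\<bar>g x - g a * \<phi> x\<bar> \<le> \<eta> + M * (1 - \<phi> x)" for x
  proof (cases "\<phi> x = 0")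
    case True
    then show ?thesis using g(2)[of x] \<open>\<eta> \<ge> 0\<close> by simp
  next
    case False
    have "\<bar>g a * (1 - \<phi> x)\<bar> \<le> M * (1 - \<phi> x)"
      using g(2)[of a] \<phi>(3)[of x] by (simp add: abs_mult mult_right_mono)
    moreover have "g x - g a * \<phi> x = (g x - g a) + g a * (1 - \<phi> x)" by (simp add: algebra_simps)
    ultimately show ?thesis using near[OF False] by linarith
  qed
  note c = C_zero_cmult[OF \<phi>(1)]
  \<comment> \<open>The term M \<phi> is moved to the left so that the function is in C_0 and the
    right side is a nonnegative constant, as \<open>T_le\<close> requires.\<close>
  have "T s (\<lambda>x. (g x - g a * \<phi> x) + M * \<phi> x) a \<le> \<eta> + M"
  proof (intro T_le s C_zero_add C_zero_diff g(1) c)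
    show "g x - g a * \<phi> x + M * \<phi> x \<le> \<eta> + M" for x using pt[of x] by (simp add: algebra_simps)
  qed (use \<open>\<eta> \<ge> 0\<close> \<open>M \<ge> 0\<close> in simp)
  then have up: "T s g a - g a * T s \<phi> a \<le> \<eta> + M * (1 - T s \<phi> a)"
    unfolding T_add[OF s C_zero_diff[OF g(1) c] c] T_diff[OF s g(1) c] T_cmult[OF s \<phi>(1)]
    by (simp add: algebra_simps)
  have "T s (\<lambda>x. (g a * \<phi> x - g x) + M * \<phi> x) a \<le> \<eta> + M"
  proof (intro T_le s C_zero_add C_zero_diff g(1) c)
    show "g a * \<phi> x - g x + M * \<phi> x \<le> \<eta> + M" for x using pt[of x] by (simp add: algebra_simps)
  qed (use \<open>\<eta> \<ge> 0\<close> \<open>M \<ge> 0\<close> in simp)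
  then have lo: "g a * T s \<phi> a - T s g a \<le> \<eta> + M * (1 - T s \<phi> a)"
    unfolding T_add[OF s C_zero_diff[OF c g(1)] c] T_diff[OF s c g(1)] T_cmult[OF s \<phi>(1)]
    by (simp add: algebra_simps)
  \<comment> \<open>Returning from g(a) T_s \<phi>(a) to g(a) costs M (1 - T_s \<phi>(a)) once more,
    whence the factor 2.\<close>
  have "\<bar>g a * (1 - T s \<phi> a)\<bar> \<le> M * (1 - T s \<phi> a)"
    using g(2)[of a] p by (simp add: abs_mult mult_right_mono)
  moreover have "T s g a - g a = (T s g a - g a * T s \<phi> a) - g a * (1 - T s \<phi> a)"
    by (simp add: algebra_simps)
  moreover have "2 * M * (1 - T s \<phi> a) = M * (1 - T s \<phi> a) + M * (1 - T s \<phi> a)" by simp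
  ultimately show ?thesis using up lo by linarith
qed

lemma (in pmp_operator) frozen_in_closure:
  assumes f: "f \<in> Cc_infty"
  shows "(f, frozen L a f) \<in> C_zero_closure (operator_graph Cc_infty (frozen L a))"
proof -
  have "uniform_limit UNIV (\<lambda>_. h) h sequentially" for h :: "real ^ 'n \<Rightarrow> real"
    by (simp add: uniform_limit_iff)
  moreover have "(f, frozen L a f) \<in> operator_graph Cc_infty (frozen L a)"
    using f by (auto simp: operator_graph_def)
  ultimately show ?thesis
    using Cc_infty_C_zero[OF f] frozen_C_zero[OF f, of a]
    unfolding C_zero_closure_def
    by simp (rule exI[where x = "\<lambda>_. f"], rule exI[where x = "\<lambda>_. frozen L a f"], simp)
qed

theorem theorem4p5:
  fixes L :: "(real ^ 'n \<Rightarrow> real) \<Rightarrow> (real ^ 'n \<Rightarrow> real)"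
    and T :: "real ^ 'n \<Rightarrow> real \<Rightarrow> (real ^ 'n \<Rightarrow> real) \<Rightarrow> (real ^ 'n \<Rightarrow> real)"
    and \<epsilon> :: "nat \<Rightarrow> real"
  assumes "\<And>f. f \<in> Cc_infty \<Longrightarrow> continuous_on UNIV (L f)"
    and "linear_operator_on Cc_infty L"
    and "positive_maximum_principle L"
    and "\<And>a0. feller_semigroup (T a0)"
    and "\<And>a0. feller_generator (T a0) = C_zero_closure (operator_graph Cc_infty (frozen L a0))"
    and "\<And>n. \<epsilon> n > 0"
    and "\<epsilon> \<longlonglongrightarrow> 0"
  shows "\<forall>f\<in>Cc_infty. \<forall>K. compact K \<longrightarrow>
           uniform_limit K
             (\<lambda>n a. (1 / \<epsilon> n) * (transition_operator T (\<epsilon> n) f a - f a))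
             (L f) sequentially"
proof (intro ballI allI impI)
  fix f :: "real ^ 'n \<Rightarrow> real" and K :: "(real ^ 'n) set"
  assume f: "f \<in> Cc_infty" and K: "compact K"
  interpret pmp_operator L by standard (fact assms)+
  have gen: "(p, frozen L a p) \<in> feller_generator (T a)" if "p \<in> Cc_infty" for p a
    unfolding assms(5) by (rule frozen_in_closure[OF that])
  obtain M where M: "M \<ge> 0" "\<forall>a\<in>K. \<forall>h. \<bar>L (translate h f) a\<bar> \<le> M"
    using L_translate_bounded[OF K f] by blast
  obtain C where C: "C \<ge> 0"
      "\<forall>a\<in>K. \<forall>h k. \<bar>L (translate (h + k) f) a - L (translate h f) a\<bar> \<le> C * norm k"
    using L_translate_lipschitz[OF K f] by blast
  show "uniform_limit K (\<lambda>n a. (1 / \<epsilon> n) * (transition_operator T (\<epsilon> n) f a - f a)) (L f) sequentially"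
    unfolding uniform_limit_iff
  proof (intro allI impI)
    fix e :: real assume "e > 0"
    define \<delta> where "\<delta> = e / 2 / (C + 1)"
    have \<delta>: "\<delta> > 0" "C * \<delta> \<le> e / 2" using \<open>e > 0\<close> C(1) by (auto simp: \<delta>_def field_simps)
    then obtain \<phi> :: "real ^ 'n \<Rightarrow> real" where \<phi>: "\<phi> \<in> Cc_infty" "\<And>x. 0 \<le> \<phi> x" "\<And>x. \<phi> x \<le> 1"
        "\<And>x. norm x \<le> \<delta> / 2 \<Longrightarrow> \<phi> x = 1" "\<And>x. norm x \<ge> 2 * (\<delta> / 2) \<Longrightarrow> \<phi> x = 0"
      using bump_exists[of "\<delta> / 2"] by (metis half_gt_zero)
    \<comment> \<open>A single bump is translated to every point of K, so one M' bounds all frozen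
      images of these bumps, uniformly in the centre.\<close>
    obtain M' where M': "M' \<ge> 0" "\<forall>a\<in>K. \<forall>h. \<bar>L (translate h \<phi>) a\<bar> \<le> M'"
      using L_translate_bounded[OF K \<phi>(1)] by blast
    have est: "\<bar>(1 / h) * (T a h f a - f a) - L f a\<bar> \<le> e / 2 + 2 * M * (h * M')"
      if a: "a \<in> K" and h: "h > 0" for a h
    proof -
      interpret Ta: feller "T a" by standard (rule assms)
      define g where "g = frozen L a f"
      have ga: "g a = L f a" by (simp add: g_def frozen_def translate_def)
      obtain s where s: "s \<in> {0<..<h}" "T a h f a - f a = h * T a s g a"
        using feller_generator_mvt[OF assms(4) gen[OF f] h] unfolding g_def by blast
      define \<psi> where "\<psi> = translate (- a) \<phi>"
      have \<psi>: "\<psi> \<in> Cc_infty" unfolding \<psi>_def by (rule Cc_infty_translate[OF \<phi>(1)])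
      have \<psi>a: "\<psi> a = 1" using \<phi>(4)[of 0] \<delta>(1) by (simp add: \<psi>_def translate_def)
      have "s > 0" using s(1) by simp
      then obtain r where r: "r \<in> {0<..<s}" "T a s \<psi> a - \<psi> a = s * T a r (frozen L a \<psi>) a"
        using feller_generator_mvt[OF assms(4) gen[OF \<psi>]] by blast
      \<comment> \<open>Freezing at \<open>a\<close> keeps the evaluation point in K whatever
        \<open>b\<close> is, so the bound M' over all translates holds on the whole space and
        survives the contraction \<open>T a r\<close>. With \<psi>(a) = 1, the mean value formula
        then bounds the lost mass by s M'.\<close>
      have "frozen L a \<psi> b = L (translate (b - a - a) \<phi>) a" for b
        by (simp add: frozen_def \<psi>_def translate_def algebra_simps)
      then have "\<bar>T a r (frozen L a \<psi>) a\<bar> \<le> M'"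
        using r(1) M'(2) a by (intro Ta.T_abs_le frozen_C_zero \<psi>) auto
      then have "s * (- T a r (frozen L a \<psi>) a) \<le> s * M'"
        using \<open>s > 0\<close> by (intro mult_left_mono) auto
      also have "\<dots> \<le> h * M'" using s(1) M'(1) by (intro mult_right_mono) auto
      finally have loss: "1 - T a s \<psi> a \<le> h * M'" using r(2) \<psi>a by simp
      have "\<bar>T a s g a - g a\<bar> \<le> e / 2 + 2 * M * (1 - T a s \<psi> a)"
      proof (rule Ta.T_localized)
        show "g \<in> C_zero" unfolding g_def by (rule frozen_C_zero[OF f])
        show "\<bar>g x\<bar> \<le> M" for x using M(2) a by (simp add: g_def frozen_def)
        show "\<psi> \<in> C_zero" by (rule Cc_infty_C_zero[OF \<psi>])
        show "\<bar>g x - g a\<bar> \<le> e / 2" if "\<psi> x \<noteq> 0" for x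
        proof -
          have "norm (x - a) \<le> \<delta>" using that \<phi>(5)[of "x - a"] by (force simp: \<psi>_def translate_def)
          then have "C * norm (x - a) \<le> e / 2" using C(1) \<delta>(2) mult_left_mono order_trans by blast
          moreover have "\<bar>L (translate (0 + (x - a)) f) a - L (translate 0 f) a\<bar> \<le> C * norm (x - a)"
            using C(2) a by blast
          ultimately show ?thesis by (simp add: g_def frozen_def)
        qed
      qed (use \<phi> s(1) \<open>e > 0\<close> in \<open>auto simp: \<psi>_def translate_def\<close>)
      also have "\<dots> \<le> e / 2 + 2 * M * (h * M')"
        using loss M(1) by (intro add_left_mono mult_left_mono) auto
      finally show ?thesis using s(2) h ga by simp
    qed
    have "(\<lambda>n. e / 2 + 2 * M * (\<epsilon> n * M')) \<longlonglongrightarrow> e / 2 + 2 * M * (0 * M')"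
      by (intro tendsto_intros assms)
    then have "\<forall>\<^sub>F n in sequentially. e / 2 + 2 * M * (\<epsilon> n * M') < e"
      by (rule order_tendstoD) (use \<open>e > 0\<close> in simp)
    then show "\<forall>\<^sub>F n in sequentially. \<forall>a\<in>K.
        dist ((1 / \<epsilon> n) * (transition_operator T (\<epsilon> n) f a - f a)) (L f a) < e"
    proof eventually_elim
      case (elim n)
      show ?case
        using est[OF _ assms(6)[of n]] elim
        by (auto simp: dist_real_def transition_operator_def intro: le_less_trans)
    qed
  qed
qed

end
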